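(* There exists an iterated function system $\mathcal{F}=\{f_1,\dots,f_k\}$ of homeomorphisms of the circle $S^1$ such that the Hutchinson operator $F$ of $\mathcal{F}$ is equicontinuous, while the Hutchinson operator $F_-$ of $\mathcal{F}_-=\{f_1^{-1},\dots,f_k^{-1}\}$ is sensitive.
   Context: An iterated function system (IFS) on a compact metric space $(X,d)$ is a finite collection of continuous self-maps of $X$. Here $X=S^1$ is the circle with its usual metric. Let $\mathcal{F}=\{f_1,\dots,f_k\}$ be an IFS of homeomorphisms of $X$ and put $\mathcal{F}_-=\{f_1^{-1},\dots,f_k^{-1}\}$. Let $\mathcal{K}(X)$ be the hyperspace of non-empty compact subsets of $X$ with the Hausdorff metric $d_H$ induced by $d$. The Hutchinson operator of $\mathcal{F}$ is $F:\mathcal{K}(X)\to\mathcal{K}(X)$, $F(A)=\bigcup_{i=1}^k f_i(A)$. The Hutchinson operator of $\mathcal{F}_-$ is $F_-:\mathcal{K}(X)\to\mathcal{K}(X)$, $F_-(A)=\bigcup_{i=1}^k f_i^{-1}(A)$. For an IFS with Hutchinson operator $F$, define the metric $d_F(x_1,x_2)=\sup_{n\in\mathbb{N}} d_H(F^n(x_1),F^n(x_2))$ for $x_1,x_2\in X$, where $F^n$ is the $n$-th iterate of $F$ and $F^n(x)$ means $F^n(\{x\})$. The Hutchinson operator $F$ is equicontinuous if the identity map $\mathrm{id}_X:(X,d)\to(X,d_F)$ is continuous at every point $x\in X$. The Hutchinson operator $F$ is sensitive if there exists $\epsilon>0$ such that every non-empty open subset of $(X,d)$ has $d_F$-diameter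 at least $\epsilon$. The same definitions apply to $F_-$, with $\mathcal{F}_-$ and $F_-$ in place of $\mathcal{F}$ and $F$. *)

theory Defs
  imports "HOL-Analysis.Analysis"
begin

text \<open>
  A compact metric space is a compact set \<open>X\<close> in a type of class \<open>metric_space\<close>, with the
  restricted metric. Self-maps of \<open>X\<close> are total functions on that type; their values outside \<open>X\<close>
  are irrelevant. An iterated function system is the finite set of its maps.
\<close>

definition ifs_on :: "'a::metric_space set \<Rightarrow> ('a \<Rightarrow> 'a) set \<Rightarrow> bool" where
  "ifs_on X \<F> \<longleftrightarrow>
     compact X \<and> finite \<F> \<and> \<F> \<noteq> {} \<and> (\<forall>f\<in>\<F>. continuous_on X f \<and> f ` X \<subseteq> X)"

definition homeo_ifs_on :: "'a::metric_space set \<Rightarrow> ('a \<Rightarrow> 'a) set \<Rightarrow> bool" where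
  "homeo_ifs_on X \<F> \<longleftrightarrow> ifs_on X \<F> \<and> (\<forall>f\<in>\<F>. \<exists>g. homeomorphism X X f g)"

definition inverse_ifs :: "'a set \<Rightarrow> ('a \<Rightarrow> 'a) set \<Rightarrow> ('a \<Rightarrow> 'a) set" where
  "inverse_ifs X \<F> = inv_into X ` \<F>"

definition hutchinson :: "('a \<Rightarrow> 'a) set \<Rightarrow> 'a set \<Rightarrow> 'a set" where
  "hutchinson \<F> A = (\<Union>f\<in>\<F>. f ` A)"

text \<open>
  Only meaningful for non-empty bounded sets, where both suprema are over non-empty bounded sets of
  reals; it is only used for the non-empty compact sets obtained by iterating a Hutchinson operator.
\<close>

definition hausdorff_dist :: "'a::metric_space set \<Rightarrow> 'a set \<Rightarrow> real" where
  "hausdorff_dist A B = max (SUP a\<in>A. infdist a B) (SUP b\<in>B. infdist b A)"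

definition hutchinson_dist :: "('a::metric_space \<Rightarrow> 'a) set \<Rightarrow> 'a \<Rightarrow> 'a \<Rightarrow> real" where
  "hutchinson_dist \<F> x y =
     (SUP n. hausdorff_dist ((hutchinson \<F> ^^ n) {x}) ((hutchinson \<F> ^^ n) {y}))"

definition hutchinson_diameter :: "('a::metric_space \<Rightarrow> 'a) set \<Rightarrow> 'a set \<Rightarrow> real" where
  "hutchinson_diameter \<F> U = (SUP (x, y)\<in>U \<times> U. hutchinson_dist \<F> x y)"

text \<open>Continuity of the identity from \<open>(X, dist)\<close> to \<open>(X, hutchinson_dist \<F>)\<close> at each point.\<close>

definition hutchinson_equicontinuous :: "'a::metric_space set \<Rightarrow> ('a \<Rightarrow> 'a) set \<Rightarrow> bool" where
  "hutchinson_equicontinuous X \<F> \<longleftrightarrow>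
     (\<forall>x\<in>X. \<forall>\<epsilon>>0. \<exists>\<delta>>0. \<forall>y\<in>X. dist x y < \<delta> \<longrightarrow> hutchinson_dist \<F> x y < \<epsilon>)"

definition hutchinson_sensitive :: "'a::metric_space set \<Rightarrow> ('a \<Rightarrow> 'a) set \<Rightarrow> bool" where
  "hutchinson_sensitive X \<F> \<longleftrightarrow>
     (\<exists>\<epsilon>>0. \<forall>U. openin (top_of_set X) U \<and> U \<noteq> {} \<longrightarrow> hutchinson_diameter \<F> U \<ge> \<epsilon>)"

end

theory Submission
  imports Defs
begin

text \<open>
  The circle is viewed as the line modulo \<open>6\<close>. On the line, the intervals \<open>[2j, 2j + 1]\<close> (cells)
  carry copies of the ternary Cantor set and the intervals \<open>(2j + 1, 2j + 2)\<close> are gaps; inside a cell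
  there are smaller cells and gaps, down to all scales. The closed set left after removing all gaps
  is called \<open>dust\<close>. The maps of the inverse system are the translations
  by \<open>0\<close>, \<open>2\<close>, \<open>4\<close> followed by a single homeomorphism \<open>lift = stretch \<circ> pad\<close>. Here \<open>pad\<close> inserts a
  digit \<open>2\<close> after every digit \<open>0\<close> of the ternary expansion of a point of the Cantor set, and is affine
  on each gap, whose image is a gap together with the first quarter of the cell of equal length to its
  right. The map
  \<open>stretch\<close> deletes the leading digit of the expansion on \<open>[0, 1]\<close>, makes room for this elsewhere, and
  carries gaps affinely onto gaps.

  Trapping. All these maps send the dust into itself, and where a point of a gap goes relative to
  the dust depends only on its relative position inside its gap, not on the gap and not on the
  choice of the translations (\<open>pad_same_type\<close>, \<open>spread_orbit_type\<close>). So if one word of inverse maps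
  sends a point to the dust, then all words of that length do, and the whole backward orbit stays in
  the dust from then on. Since relative lengths inside gaps grow by a factor of at least \<open>5/4\<close> as
  long as the dust is not met, points with this fate are dense (\<open>spread_orbit_trapped\<close>).

  Exactness. On the other hand the backward images of any interval eventually cover everything
  (\<open>open_interval_grows\<close>). Once the interval has reached the dust it contains a gap, which is
  described by the finite list of digits leading to it; each step pads this list and deletes its
  first digit. Although padding lengthens the list, this ends: padding creates only digits \<open>2\<close>, and
  these are not multiplied by further padding (\<open>opens_padded\<close>). The gap has then been enlarged to one
  of the intervals \<open>[2j + 1, 2j + 2]\<close>, which spreads over the circle in three steps.

  A point \<open>y\<close> lies in the \<open>n\<close>-th forward image of \<open>x\<close> iff \<open>x\<close> lies in the \<open>n\<close>-th backward image of
  \<open>y\<close>. Hence exactness of the inverse system makes all forward orbits \<open>\<epsilon>\<close>-dense at a time that does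
  not depend on the starting point, and only finitely many times matter for equicontinuity
  (\<open>equicontinuous_if_backward_exact\<close>). At the same time every open arc contains a point whose
  backward images end up in the dust, and points having the centre of a fixed gap among their
  backward images of any large order; so the inverse system is sensitive
  (\<open>inverse_sensitive_if_trapped\<close>).
\<close>

section \<open>Exact backward dynamics\<close>

lemma hutchinson_funpow_points: "(hutchinson \<F> ^^ n) A = (\<Union>a\<in>A. (hutchinson \<F> ^^ n) {a})"
proof (induction n)
  case (Suc n)
  have "(hutchinson \<F> ^^ Suc n) A = hutchinson \<F> (\<Union>a\<in>A. (hutchinson \<F> ^^ n) {a})"
    using Suc by simp
  also have "\<dots> = (\<Union>a\<in>A. (hutchinson \<F> ^^ Suc n) {a})" by (auto simp: hutchinson_def)
  finally show ?case .
qed simp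

lemma hutchinson_orbit_in:
  assumes "\<And>f. f \<in> \<F> \<Longrightarrow> f ` X \<subseteq> X" "\<F> \<noteq> {}" "x \<in> X"
  shows "(hutchinson \<F> ^^ n) {x} \<subseteq> X \<and> (hutchinson \<F> ^^ n) {x} \<noteq> {}"
proof (induction n)
  case (Suc n)
  then show ?case using assms by (auto simp: hutchinson_def)
qed (use assms in simp)

lemma homeo_ifs_onD:
  assumes "homeo_ifs_on X \<F>" "f \<in> \<F>"
  shows "bij_betw f X X" "continuous_on X f"
proof -
  obtain g where "homeomorphism X X f g" using assms unfolding homeo_ifs_on_def by blast
  then show "bij_betw f X X" by (auto simp: homeomorphism_def bij_betw_def intro: inj_on_inverseI)
  show "continuous_on X f" using assms unfolding homeo_ifs_on_def ifs_on_def by blast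
qed

lemma inverse_ifs_maps:
  assumes "homeo_ifs_on X \<F>" "g \<in> inverse_ifs X \<F>"
  shows "g ` X \<subseteq> X"
proof -
  obtain f where "f \<in> \<F>" "g = inv_into X f" using assms(2) by (auto simp: inverse_ifs_def)
  then show ?thesis
    using bij_betw_inv_into[OF homeo_ifs_onD(1)[OF assms(1)]] by (simp add: bij_betw_def)
qed

text \<open>
  Reversing a word of homeomorphisms exchanges the roles of its start and its end.
\<close>

lemma hutchinson_inverse_orbit:
  assumes "homeo_ifs_on X \<F>" "x \<in> X" "y \<in> X"
  shows "y \<in> (hutchinson \<F> ^^ n) {x} \<longleftrightarrow> x \<in> (hutchinson (inverse_ifs X \<F>) ^^ n) {y}"
  using assms(3)
proof (induction n arbitrary: y)
  case (Suc n)
  have ne: "\<F> \<noteq> {}" using assms(1) by (auto simp: homeo_ifs_on_def ifs_on_def)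
  have maps: "f ` X \<subseteq> X" if "f \<in> \<F>" for f using homeo_ifs_onD(1)[OF assms(1) that] by (simp add: bij_betw_def)
  have bij: "bij_betw f X X" if "f \<in> \<F>" for f using homeo_ifs_onD(1)[OF assms(1) that] .
  have "y \<in> (hutchinson \<F> ^^ Suc n) {x} \<longleftrightarrow> (\<exists>f\<in>\<F>. \<exists>z\<in>(hutchinson \<F> ^^ n) {x}. y = f z)"
    by (auto simp: hutchinson_def)
  also have "\<dots> \<longleftrightarrow> (\<exists>f\<in>\<F>. inv_into X f y \<in> (hutchinson \<F> ^^ n) {x})"
    using bij Suc.prems hutchinson_orbit_in[OF maps ne assms(2)]
    by (metis bij_betw_inv_into_left bij_betw_inv_into_right subsetD)
  also have "\<dots> \<longleftrightarrow> (\<exists>f\<in>\<F>. x \<in> (hutchinson (inverse_ifs X \<F>) ^^ n) {inv_into X f y})"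
    using Suc.IH bij Suc.prems by (metis bij_betw_apply bij_betw_inv_into)
  also have "\<dots> \<longleftrightarrow> x \<in> (hutchinson (inverse_ifs X \<F>) ^^ n) (hutchinson (inverse_ifs X \<F>) {y})"
    by (subst (2) hutchinson_funpow_points) (auto simp: hutchinson_def inverse_ifs_def)
  finally show ?case by (simp add: funpow_swap1)
qed auto

lemma hausdorff_dist_le:
  assumes "A \<noteq> {}" "B \<noteq> {}"
    and "\<And>a. a \<in> A \<Longrightarrow> \<exists>b\<in>B. dist a b \<le> e" "\<And>b. b \<in> B \<Longrightarrow> \<exists>a\<in>A. dist b a \<le> e"
  shows "hausdorff_dist A B \<le> e"
  unfolding hausdorff_dist_def using assms by (intro max.boundedI cSUP_least) (auto intro: infdist_le2)

lemma hausdorff_dist_ge: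
  assumes "bounded B" "A \<noteq> {}" "b \<in> B" "\<And>a. a \<in> A \<Longrightarrow> e \<le> dist b a"
  shows "e \<le> hausdorff_dist A B"
proof -
  obtain a where a: "a \<in> A" using assms(2) by blast
  obtain M where "\<And>x. x \<in> B \<Longrightarrow> dist a x \<le> M"
    using assms(1) unfolding bounded_any_center[where a = a] by blast
  then have "infdist x A \<le> M" if "x \<in> B" for x
    using that infdist_le[OF a, of x] by (metis dist_commute order_trans)
  then have bdd: "bdd_above ((\<lambda>b. infdist b A) ` B)" by (rule bdd_aboveI2)
  have "e \<le> infdist b A" using assms(2,4) by (simp add: infdist_notempty cINF_greatest)
  also have "\<dots> \<le> (SUP b\<in>B. infdist b A)" using bdd assms(3) by (rule cSUP_upper2) simp
  finally show ?thesis by (simp add: hausdorff_dist_def)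
qed

lemma hausdorff_dist_le_diameter:
  assumes "bounded X" "A \<subseteq> X" "B \<subseteq> X" "A \<noteq> {}" "B \<noteq> {}"
  shows "hausdorff_dist A B \<le> diameter X"
  using assms diameter_bounded_bound[OF assms(1)] by (intro hausdorff_dist_le) blast+

text \<open>
  Used to make a modulus of continuity uniform over finitely many maps or finitely many times.
\<close>

lemma common_radius:
  fixes Q :: "'a \<Rightarrow> real \<Rightarrow> bool"
  assumes "finite S" "\<And>s. s \<in> S \<Longrightarrow> \<exists>d>0. Q s d"
    and mono: "\<And>s d d'. Q s d \<Longrightarrow> 0 < d' \<Longrightarrow> d' \<le> d \<Longrightarrow> Q s d'"
  shows "\<exists>d>0. \<forall>s\<in>S. Q s d"
  using assms(1,2)
proof (induction S)
  case empty
  then show ?case by (intro exI[of _ 1]) auto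
next
  case (insert s S)
  obtain d where d: "d > 0" "\<forall>s\<in>S. Q s d" using insert.IH[OF insert.prems[OF insertI2]] by blast
  obtain d' where d': "d' > 0" "Q s d'" using insert.prems[OF insertI1] by blast
  have "Q s (min d d')" using d d' by (intro mono[OF d'(2)]) auto
  moreover have "Q t (min d d')" if "t \<in> S" for t using d d' that by (intro mono[OF bspec[OF d(2) that]]) auto
  ultimately show ?case using d(1) d'(1) by (intro exI[of _ "min d d'"]) simp
qed

lemma hutchinson_orbit_uniformly_continuous:
  assumes ifs: "homeo_ifs_on X \<F>" and "e > 0"
  shows "\<exists>d>0. \<forall>x\<in>X. \<forall>y\<in>X. dist x y < d \<longrightarrow>
    (\<forall>a\<in>(hutchinson \<F> ^^ n) {x}. \<exists>b\<in>(hutchinson \<F> ^^ n) {y}. dist a b < e)"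
  using \<open>e > 0\<close>
proof (induction n arbitrary: e)
  case 0
  then show ?case by auto
next
  case (Suc n)
  have ne: "\<F> \<noteq> {}" "finite \<F>" "compact X" using ifs by (auto simp: homeo_ifs_on_def ifs_on_def)
  have maps: "f ` X \<subseteq> X" if "f \<in> \<F>" for f using homeo_ifs_onD(1)[OF ifs that] by (simp add: bij_betw_def)
  have "\<exists>d>0. \<forall>f\<in>\<F>. \<forall>u\<in>X. \<forall>v\<in>X. dist u v < d \<longrightarrow> dist (f u) (f v) < e"
  proof (rule common_radius[OF ne(2)])
    fix f assume "f \<in> \<F>"
    then have "uniformly_continuous_on X f"
      using homeo_ifs_onD(2)[OF ifs] ne(3) by (intro compact_uniformly_continuous) auto
    then show "\<exists>d>0. \<forall>u\<in>X. \<forall>v\<in>X. dist u v < d \<longrightarrow> dist (f u) (f v) < e"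
      using Suc.prems unfolding uniformly_continuous_on_def by (metis dist_commute)
  qed auto
  then obtain d' where d': "d' > 0"
    "\<And>f u v. f \<in> \<F> \<Longrightarrow> u \<in> X \<Longrightarrow> v \<in> X \<Longrightarrow> dist u v < d' \<Longrightarrow> dist (f u) (f v) < e" by blast
  obtain d where d: "d > 0" "\<And>x y a. x \<in> X \<Longrightarrow> y \<in> X \<Longrightarrow> dist x y < d \<Longrightarrow>
    a \<in> (hutchinson \<F> ^^ n) {x} \<Longrightarrow> \<exists>b\<in>(hutchinson \<F> ^^ n) {y}. dist a b < d'"
    using Suc.IH[OF d'(1)] by blast
  show ?case
  proof (intro exI conjI ballI impI)
    show "d > 0" by fact
    fix x y a assume xy: "x \<in> X" "y \<in> X" "dist x y < d" and "a \<in> (hutchinson \<F> ^^ Suc n) {x}"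
    then obtain f u where fu: "f \<in> \<F>" "u \<in> (hutchinson \<F> ^^ n) {x}" "a = f u"
      by (auto simp: hutchinson_def)
    obtain v where v: "v \<in> (hutchinson \<F> ^^ n) {y}" "dist u v < d'" using d(2)[OF xy fu(2)] by blast
    have "u \<in> X" "v \<in> X" using fu(2) v(1) hutchinson_orbit_in[OF maps ne(1)] xy by blast+
    then have "dist a (f v) < e" using d'(2) fu v by simp
    moreover have "f v \<in> (hutchinson \<F> ^^ Suc n) {y}" using fu(1) v(1) by (auto simp: hutchinson_def)
    ultimately show "\<exists>b\<in>(hutchinson \<F> ^^ Suc n) {y}. dist a b < e" by blast
  qed
qed

text \<open>
  Local eventual onto-ness of the inverse system: the analogue for Hutchinson operators of a
  topologically exact map.
\<close>

definition backward_exact :: "'a::metric_space set \<Rightarrow> ('a \<Rightarrow> 'a) set \<Rightarrow> bool" where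
  "backward_exact X \<F> \<longleftrightarrow> (\<forall>V. openin (top_of_set X) V \<and> V \<noteq> {} \<longrightarrow>
     (\<exists>n. X \<subseteq> (hutchinson (inverse_ifs X \<F>) ^^ n) V))"

text \<open>
  If the backward images of \<open>V\<close> fill \<open>X\<close> at time \<open>N\<close>, then every forward orbit visits \<open>V\<close> at time \<open>N\<close>
  by duality, and at any later time because the last \<open>N\<close> steps can be split off.
\<close>

lemma backward_exact_orbits_meet:
  assumes ifs: "homeo_ifs_on X \<F>" and exact: "backward_exact X \<F>"
    and V: "openin (top_of_set X) V" "V \<noteq> {}"
  shows "\<exists>N. \<forall>n\<ge>N. \<forall>y\<in>X. (hutchinson \<F> ^^ n) {y} \<inter> V \<noteq> {}"
proof -
  have ne: "\<F> \<noteq> {}" using ifs by (auto simp: homeo_ifs_on_def ifs_on_def)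
  have maps: "f ` X \<subseteq> X" if "f \<in> \<F>" for f using homeo_ifs_onD(1)[OF ifs that] by (simp add: bij_betw_def)
  obtain N where N: "X \<subseteq> (hutchinson (inverse_ifs X \<F>) ^^ N) V"
    using exact V unfolding backward_exact_def by blast
  have VX: "V \<subseteq> X" using V(1) openin_imp_subset by blast
  have "(hutchinson \<F> ^^ n) {y} \<inter> V \<noteq> {}" if n: "n \<ge> N" and y: "y \<in> X" for n y
  proof -
    obtain z where z: "z \<in> X" "z \<in> (hutchinson \<F> ^^ (n - N)) {y}"
      using hutchinson_orbit_in[OF maps ne y] by blast
    obtain v where v: "v \<in> V" "z \<in> (hutchinson (inverse_ifs X \<F>) ^^ N) {v}"
      using N z(1) hutchinson_funpow_points[of N _ V] by blast
    then have "v \<in> (hutchinson \<F> ^^ N) {z}" using hutchinson_inverse_orbit[OF ifs z(1)] VX by blast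
    then have "v \<in> (hutchinson \<F> ^^ N) ((hutchinson \<F> ^^ (n - N)) {y})"
      using z(2) hutchinson_funpow_points[of N \<F> "(hutchinson \<F> ^^ (n - N)) {y}"] by blast
    then have "v \<in> (hutchinson \<F> ^^ n) {y}"
      using n by (metis comp_apply funpow_add le_add_diff_inverse)
    then show ?thesis using v(1) by blast
  qed
  then show ?thesis by blast
qed

text \<open>
  Compactness: finitely many balls suffice, so one time serves all of them.
\<close>

lemma backward_exact_orbits_dense:
  assumes ifs: "homeo_ifs_on X \<F>" and exact: "backward_exact X \<F>" and "e > 0"
  shows "\<exists>N. \<forall>n\<ge>N. \<forall>y\<in>X. \<forall>x\<in>X. \<exists>z\<in>(hutchinson \<F> ^^ n) {y}. dist x z < e"
proof -
  have "compact X" using ifs by (auto simp: homeo_ifs_on_def ifs_on_def)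
  then obtain C where C: "finite C" "X \<subseteq> (\<Union>c\<in>C. ball c (e / 2))"
    using \<open>e > 0\<close> unfolding compact_eq_totally_bounded by (meson half_gt_zero)
  have "\<exists>N. \<forall>n\<ge>N. \<forall>y\<in>X. X \<inter> ball c (e / 2) \<noteq> {} \<longrightarrow>
      (hutchinson \<F> ^^ n) {y} \<inter> (X \<inter> ball c (e / 2)) \<noteq> {}" for c
  proof (cases "X \<inter> ball c (e / 2) = {}")
    case False
    then show ?thesis using backward_exact_orbits_meet[OF ifs exact] by (metis openin_open_Int open_ball)
  qed auto
  then obtain N where N: "\<And>c n y. n \<ge> N c \<Longrightarrow> y \<in> X \<Longrightarrow> X \<inter> ball c (e / 2) \<noteq> {} \<Longrightarrow>
      (hutchinson \<F> ^^ n) {y} \<inter> (X \<inter> ball c (e / 2)) \<noteq> {}" by metis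
  have "\<exists>z\<in>(hutchinson \<F> ^^ n) {y}. dist x z < e" if n: "n \<ge> Max (N ` C)" and xy: "y \<in> X" "x \<in> X" for n x y
  proof -
    obtain c where c: "c \<in> C" "dist c x < e / 2" using C(2) xy by auto
    have "N c \<le> n" using n c(1) C(1) by (meson Max_ge finite_imageI image_eqI order_trans)
    then obtain z where "z \<in> (hutchinson \<F> ^^ n) {y}" "dist c z < e / 2"
      using N[of c n y] xy c(2) by (auto simp: disjoint_iff)
    then show ?thesis using c(2) dist_triangle_half_r by blast
  qed
  then show ?thesis by blast
qed

text \<open>
  Late images of any two points are both nearly all of \<open>X\<close>, hence close to each other; for the
  finitely many early times ordinary continuity is enough.
\<close>

theorem equicontinuous_if_backward_exact:
  assumes ifs: "homeo_ifs_on X \<F>" and exact: "backward_exact X \<F>"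
  shows "hutchinson_equicontinuous X \<F>"
  unfolding hutchinson_equicontinuous_def
proof (intro ballI allI impI)
  fix x and e :: real assume x: "x \<in> X" and "e > 0"
  have ne: "\<F> \<noteq> {}" using ifs by (auto simp: homeo_ifs_on_def ifs_on_def)
  have maps: "f ` X \<subseteq> X" if "f \<in> \<F>" for f using homeo_ifs_onD(1)[OF ifs that] by (simp add: bij_betw_def)
  define close where "close n y z \<longleftrightarrow> (\<forall>a\<in>(hutchinson \<F> ^^ n) {y}. \<exists>b\<in>(hutchinson \<F> ^^ n) {z}. dist a b < e / 2)"
    for n y z
  obtain N where N: "\<And>n y u. n \<ge> N \<Longrightarrow> y \<in> X \<Longrightarrow> u \<in> X \<Longrightarrow> \<exists>z\<in>(hutchinson \<F> ^^ n) {y}. dist u z < e / 2"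
    using backward_exact_orbits_dense[OF ifs exact, OF half_gt_zero[OF \<open>e > 0\<close>]] by blast
  have "\<exists>d>0. \<forall>n\<in>{..<N}. \<forall>y\<in>X. \<forall>z\<in>X. dist y z < d \<longrightarrow> close n y z"
  proof (rule common_radius)
    show "\<exists>d>0. \<forall>y\<in>X. \<forall>z\<in>X. dist y z < d \<longrightarrow> close n y z" for n
      using hutchinson_orbit_uniformly_continuous[OF ifs, of "e / 2" n] \<open>e > 0\<close> unfolding close_def by simp
  qed auto
  then obtain d where d: "d > 0"
    "\<And>n y z. n < N \<Longrightarrow> y \<in> X \<Longrightarrow> z \<in> X \<Longrightarrow> dist y z < d \<Longrightarrow> close n y z" by blast
  show "\<exists>d>0. \<forall>y\<in>X. dist x y < d \<longrightarrow> hutchinson_dist \<F> x y < e"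
  proof (intro exI[of _ d] conjI ballI impI)
    show "d > 0" by fact
    fix y assume y: "y \<in> X" "dist x y < d"
    have "close n u v" if "u \<in> X" "v \<in> X" "dist u v < d" for n u v
    proof (cases "n < N")
      case True
      then show ?thesis using d that by blast
    next
      case False
      then show ?thesis
        unfolding close_def using N that hutchinson_orbit_in[OF maps ne that(1)] by (meson not_less subsetD)
    qed
    then have "close n x y" "close n y x" for n using x y by (simp_all add: dist_commute)
    then have "hausdorff_dist ((hutchinson \<F> ^^ n) {x}) ((hutchinson \<F> ^^ n) {y}) \<le> e / 2" for n
      using hutchinson_orbit_in[OF maps ne x] hutchinson_orbit_in[OF maps ne y(1)]
      unfolding close_def by (intro hausdorff_dist_le) (blast intro: less_imp_le)+
    then have "hutchinson_dist \<F> x y \<le> e / 2" unfolding hutchinson_dist_def by (intro cSUP_least) auto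
    then show "hutchinson_dist \<F> x y < e" using \<open>e > 0\<close> by simp
  qed
qed

text \<open>
  By exactness an open set \<open>V\<close> contains, at every late time, a point with \<open>c\<close> among its backward
  images, while the trapped point of \<open>V\<close> keeps its images away from \<open>c\<close>.
\<close>

theorem inverse_sensitive_if_trapped:
  assumes ifs: "homeo_ifs_on X \<F>" and exact: "backward_exact X \<F>"
    and c: "c \<in> X" "e > 0"
    and trap: "\<And>V. openin (top_of_set X) V \<Longrightarrow> V \<noteq> {} \<Longrightarrow>
      \<exists>x\<in>V. \<exists>N. \<forall>n\<ge>N. \<forall>z\<in>(hutchinson (inverse_ifs X \<F>) ^^ n) {x}. e \<le> dist c z"
  shows "hutchinson_sensitive X (inverse_ifs X \<F>)"
  unfolding hutchinson_sensitive_def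
proof (intro exI[of _ e] conjI allI impI)
  show "e > 0" by fact
  fix V assume V: "openin (top_of_set X) V \<and> V \<noteq> {}"
  define G where "G = inverse_ifs X \<F>"
  have ne: "G \<noteq> {}" using ifs by (auto simp: homeo_ifs_on_def ifs_on_def inverse_ifs_def G_def)
  have maps: "g ` X \<subseteq> X" if "g \<in> G" for g using inverse_ifs_maps[OF ifs] that by (simp add: G_def)
  have "compact X" using ifs by (auto simp: homeo_ifs_on_def ifs_on_def)
  then have bX: "bounded X" by (rule compact_imp_bounded)
  have VX: "V \<subseteq> X" using V openin_imp_subset by blast
  obtain x N where x: "x \<in> V" "\<And>n z. n \<ge> N \<Longrightarrow> z \<in> (hutchinson G ^^ n) {x} \<Longrightarrow> e \<le> dist c z"
    using trap[of V] V unfolding G_def by blast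
  obtain M where M: "\<And>n. n \<ge> M \<Longrightarrow> (hutchinson \<F> ^^ n) {c} \<inter> V \<noteq> {}"
    using backward_exact_orbits_meet[OF ifs exact, of V] V c(1) by blast
  obtain y where y: "y \<in> V" "y \<in> (hutchinson \<F> ^^ max M N) {c}" using M[of "max M N"] by auto
  then have cy: "c \<in> (hutchinson G ^^ max M N) {y}"
    using hutchinson_inverse_orbit[OF ifs c(1)] VX unfolding G_def by blast
  have orb: "(hutchinson G ^^ n) {u} \<subseteq> X \<and> (hutchinson G ^^ n) {u} \<noteq> {}" if "u \<in> V" for u n
    using hutchinson_orbit_in[OF maps ne] VX that by blast
  have le: "hausdorff_dist ((hutchinson G ^^ n) {u}) ((hutchinson G ^^ n) {v}) \<le> diameter X" if "u \<in> V" "v \<in> V" for u v n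
    using orb[OF that(1)] orb[OF that(2)] by (intro hausdorff_dist_le_diameter bX) auto
  have "e \<le> hausdorff_dist ((hutchinson G ^^ max M N) {x}) ((hutchinson G ^^ max M N) {y})"
  proof (rule hausdorff_dist_ge)
    show "bounded ((hutchinson G ^^ max M N) {y})" using orb[OF y(1)] bX bounded_subset by blast
    show "(hutchinson G ^^ max M N) {x} \<noteq> {}" using orb[OF x(1)] by blast
    show "c \<in> (hutchinson G ^^ max M N) {y}" by (rule cy)
    show "e \<le> dist c a" if "a \<in> (hutchinson G ^^ max M N) {x}" for a
      using x(2)[OF _ that] by simp
  qed
  also have "\<dots> \<le> hutchinson_dist G x y"
    unfolding hutchinson_dist_def
    by (rule cSUP_upper[OF UNIV_I bdd_aboveI2[of _ _ "diameter X"]]) (rule le[OF x(1) y(1)])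
  also have "\<dots> \<le> hutchinson_diameter G V"
  proof -
    have "hutchinson_dist G u v \<le> diameter X" if "u \<in> V" "v \<in> V" for u v
      unfolding hutchinson_dist_def using le[OF that] by (intro cSUP_least) auto
    then have "bdd_above ((\<lambda>(u, v). hutchinson_dist G u v) ` (V \<times> V))"
      by (intro bdd_aboveI2[of _ _ "diameter X"]) auto
    then show ?thesis
      unfolding hutchinson_diameter_def using x(1) y(1)
      by (intro cSUP_upper2[where x = "(x, y)"]) auto
  qed
  finally show "e \<le> hutchinson_diameter (inverse_ifs X \<F>) V" by (simp add: G_def)
qed

section \<open>A periodic Cantor set and the position inside its gaps\<close>

text \<open>
  \<open>in_gap x t\<close>: the point \<open>x\<close> lies in a gap, and divides it in the ratio \<open>t : 1 - t\<close>. The second rule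
  uses that \<open>[0, 1]\<close>, scaled by \<open>3\<close>, becomes the interval \<open>[0, 3]\<close> of the same periodic pattern: two
  cells separated by a gap.
\<close>

inductive in_gap :: "real \<Rightarrow> real \<Rightarrow> bool" where
  outer: "2 * of_int j + 1 < x \<Longrightarrow> x < 2 * of_int j + 2 \<Longrightarrow> in_gap x (x - 2 * of_int j - 1)"
| inner: "2 * of_int j \<le> x \<Longrightarrow> x \<le> 2 * of_int j + 1 \<Longrightarrow> in_gap (3 * (x - 2 * of_int j)) t \<Longrightarrow> in_gap x t"

lemma cell_cases:
  fixes x :: real
  obtains j :: int where "2 * of_int j \<le> x" "x \<le> 2 * of_int j + 1"
    | j :: int where "2 * of_int j + 1 < x" "x < 2 * of_int j + 2"
proof -
  have "2 * of_int \<lfloor>x/2\<rfloor> \<le> x" "x < 2 * of_int \<lfloor>x/2\<rfloor> + 2" by linarith+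
  then show ?thesis using that by (meson not_le)
qed

lemma int_eq_near: "\<lbrakk>2 * real_of_int i < 2 * of_int j + 2; 2 * real_of_int j < 2 * of_int i + 2\<rbrakk> \<Longrightarrow> i = j"
  by linarith

lemma in_gap_shift:
  assumes "in_gap x t"
  shows "in_gap (x + 2 * of_int i) t"
  using assms
proof cases
  case (outer j)
  then show ?thesis using in_gap.outer[of "j+i" "x + 2 * of_int i"] by simp
next
  case (inner j)
  then show ?thesis using in_gap.inner[of "j+i" "x + 2 * of_int i" t] by (simp add: algebra_simps)
qed

lemma in_gap_outer_iff:
  assumes "2 * of_int j + 1 < x" "x < 2 * of_int j + 2"
  shows "in_gap x t \<longleftrightarrow> t = x - 2 * of_int j - 1"
proof
  assume "in_gap x t"
  then show "t = x - 2 * of_int j - 1"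
  proof cases
    case (outer i)
    then have "i = j" using assms by (intro int_eq_near) linarith+
    then show ?thesis using outer by simp
  next
    case (inner i)
    then have "i = j" using assms by (intro int_eq_near) linarith+
    then show ?thesis using inner assms by linarith
  qed
qed (use assms in_gap.outer in blast)

lemma in_gap_inner_iff:
  assumes "2 * of_int j \<le> x" "x \<le> 2 * of_int j + 1"
  shows "in_gap x t \<longleftrightarrow> in_gap (3 * (x - 2 * of_int j)) t"
proof
  assume "in_gap x t"
  then show "in_gap (3 * (x - 2 * of_int j)) t"
  proof cases
    case (outer i)
    then have "i = j" using assms by (intro int_eq_near) linarith+
    then show ?thesis using outer assms by linarith
  next
    case (inner i)
    have "i = j" using inner assms by (intro int_eq_near) linarith+
    show ?thesis using inner(3) unfolding \<open>i = j\<close> .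
  qed
qed (use assms in_gap.inner in blast)

lemma in_gap_shift_iff: "in_gap (x + 2 * of_int i) t \<longleftrightarrow> in_gap x t"
  using in_gap_shift[of x t i] in_gap_shift[of "x + 2 * of_int i" t "-i"] by auto

lemma in_gap_third_iff: "0 \<le> x \<Longrightarrow> x \<le> 3 \<Longrightarrow> in_gap (x / 3) t \<longleftrightarrow> in_gap x t"
  using in_gap_inner_iff[of 0 "x/3" t] by simp

lemma in_gap_unique: "in_gap x s \<Longrightarrow> in_gap x t \<Longrightarrow> s = t"
  by (induction arbitrary: t rule: in_gap.induct) (auto simp: in_gap_outer_iff in_gap_inner_iff)

lemma in_gap_range: "in_gap x t \<Longrightarrow> 0 < t \<and> t < 1"
  by (induction rule: in_gap.induct) auto

text \<open>
  Two points have the same type if they have the same relative position in their gaps, or if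
  both lie in the Cantor set.
\<close>

definition same_type :: "real \<Rightarrow> real \<Rightarrow> bool" (infix "\<approx>\<^sub>g" 50) where
  "x \<approx>\<^sub>g y \<longleftrightarrow> (\<forall>t. in_gap x t \<longleftrightarrow> in_gap y t)"

definition dust :: "real set" where
  "dust = {x. \<forall>t. \<not> in_gap x t}"

lemma same_type_refl: "x \<approx>\<^sub>g x" and same_type_sym: "x \<approx>\<^sub>g y \<Longrightarrow> y \<approx>\<^sub>g x"
  and same_type_trans [trans]: "x \<approx>\<^sub>g y \<Longrightarrow> y \<approx>\<^sub>g z \<Longrightarrow> x \<approx>\<^sub>g z"
  by (auto simp: same_type_def)

lemma same_type_shift: "x + 2 * of_int i \<approx>\<^sub>g x"
  by (simp add: same_type_def in_gap_shift_iff)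

lemma same_type_third: "0 \<le> x \<Longrightarrow> x \<le> 3 \<Longrightarrow> x / 3 \<approx>\<^sub>g x"
  by (simp add: same_type_def in_gap_third_iff)

lemma dust_same_type: "x \<approx>\<^sub>g y \<Longrightarrow> x \<in> dust \<longleftrightarrow> y \<in> dust"
  by (simp add: same_type_def dust_def)

lemma int_in_dust: "of_int i \<in> dust"
proof -
  have no: "in_gap x t \<Longrightarrow> x \<notin> \<int>" for x t
  proof (induction rule: in_gap.induct)
    case (outer j x)
    show ?case
    proof
      assume "x \<in> \<int>"
      then obtain z where "x = of_int z" by (auto elim: Ints_cases)
      with outer have "2 * j + 1 < z" "z < 2 * j + 2" by linarith+
      then show False by simp
    qed
  next
    case (inner j x t)
    then show ?case
      by (metis Ints_diff Ints_mult Ints_numeral Ints_of_int)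
  qed
  show ?thesis using no[of "of_int i"] by (auto simp: dust_def)
qed

text \<open>
  An interval avoiding the Cantor set lies in a single gap, and the relative position is affine
  there, with slope at least \<open>1\<close> since no gap is longer than \<open>1\<close>.
\<close>

lemma gap_affine:
  assumes "a < b" and free: "{a<..<b} \<inter> dust = {}"
  shows "\<exists>m\<ge>1. \<exists>q. \<forall>x\<in>{a<..<b}. in_gap x (m * x + q)"
proof -
  have "\<exists>m\<ge>1. \<exists>q. \<forall>x\<in>{a<..<b}. in_gap x (m * x + q)"
    if "in_gap x t" "a < x" "x < b" "{a<..<b} \<inter> dust = {}" for x t
    using that
  proof (induction arbitrary: a b rule: in_gap.induct)
    case (outer j x)
    have nd: "2 * of_int j + 1 \<in> dust" "2 * of_int j + 2 \<in> dust"
      using int_in_dust[of "2*j+1"] int_in_dust[of "2*j+2"] by simp_all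
    then have ab: "2 * of_int j + 1 \<le> a" "b \<le> 2 * of_int j + 2"
      using outer by (smt (verit, best) disjoint_iff greaterThanLessThan_iff)+
    show ?case
    proof (intro exI conjI ballI)
      fix y assume "y \<in> {a<..<b}"
      then show "in_gap y (1 * y + (- 2 * of_int j - 1))"
        using ab in_gap.outer[of j y] by (simp add: algebra_simps)
    qed simp
  next
    case (inner j x t)
    have nd: "2 * of_int j \<in> dust" "2 * of_int j + 1 \<in> dust"
      using int_in_dust[of "2*j"] int_in_dust[of "2*j+1"] by simp_all
    moreover have "x \<notin> dust" using inner.prems by auto
    ultimately have ab: "2 * of_int j \<le> a" "b \<le> 2 * of_int j + 1"
      using inner.prems inner.hyps
      by (smt (verit, best) disjoint_iff greaterThanLessThan_iff)+
    have "{3 * (a - 2 * of_int j)<..<3 * (b - 2 * of_int j)} \<inter> dust = {}"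
    proof -
      have "y \<notin> dust" if "3 * (a - 2 * of_int j) < y" "y < 3 * (b - 2 * of_int j)" for y
      proof -
        define z where "z = y / 3 + 2 * of_int j"
        have z: "z \<in> {a<..<b}" "2 * of_int j \<le> z" "z \<le> 2 * of_int j + 1" "3 * (z - 2 * of_int j) = y"
          using that ab by (auto simp: z_def)
        then have "z \<notin> dust" using inner.prems by blast
        then show ?thesis using in_gap_inner_iff[OF z(2,3)] z(4) by (auto simp: dust_def)
      qed
      then show ?thesis by auto
    qed
    then have "\<exists>m\<ge>1. \<exists>q. \<forall>y\<in>{3 * (a - 2 * of_int j)<..<3 * (b - 2 * of_int j)}. in_gap y (m * y + q)"
      using inner.prems by (intro inner.IH) auto
    then obtain m q where mq: "m \<ge> 1"
      "\<And>y. y \<in> {3 * (a - 2 * of_int j)<..<3 * (b - 2 * of_int j)} \<Longrightarrow> in_gap y (m * y + q)"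
      by blast
    show ?case
    proof (intro exI conjI ballI)
      show "3 * m \<ge> 1" using mq by simp
      fix y assume y: "y \<in> {a<..<b}"
      then have "in_gap (3 * (y - 2 * of_int j)) (m * (3 * (y - 2 * of_int j)) + q)"
        by (intro mq) auto
      then show "in_gap y (3 * m * y + (q - 6 * m * of_int j))"
        using y ab in_gap_inner_iff[of j y] by (simp add: algebra_simps)
    qed
  qed
  moreover have "(a + b) / 2 \<in> {a<..<b}" using \<open>a < b\<close> by simp
  moreover then obtain t where "in_gap ((a + b) / 2) t" using free unfolding dust_def by blast
  ultimately show ?thesis using free by simp
qed

section \<open>Monotone functions on the line\<close>

text \<open>
  Lets piecewise formulas with integer breakpoints be treated one unit interval at a time.
\<close>

lemma strict_mono_from_unit_intervals:
  fixes f :: "real \<Rightarrow> real"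
  assumes step: "\<And>(k::int) x y. of_int k \<le> x \<Longrightarrow> x < y \<Longrightarrow> y \<le> of_int k + 1 \<Longrightarrow> f x < f y"
  shows "strict_mono f"
proof -
  have *: "f x < f y" if "x < y" "y \<le> of_int \<lfloor>x\<rfloor> + 1 + real n" for x y n
    using that
  proof (induction n arbitrary: y)
    case 0
    then show ?case using step[of "\<lfloor>x\<rfloor>" x y] by simp
  next
    case (Suc n)
    define z where "z = of_int \<lfloor>x\<rfloor> + 1 + real n"
    have xz: "x < z" unfolding z_def by linarith
    show ?case
    proof (cases "y \<le> z")
      case True
      then show ?thesis using Suc by (simp add: z_def)
    next
      case False
      have "f x < f z" using Suc.IH[of z] xz by (simp add: z_def)
      also have "f z < f y" using step[of "\<lfloor>x\<rfloor> + 1 + int n" z y] False Suc.prems by (simp add: z_def)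
      finally show ?thesis .
    qed
  qed
  show ?thesis
  proof (rule strict_monoI)
    fix x y :: real assume "x < y"
    obtain n :: nat where "y - of_int \<lfloor>x\<rfloor> - 1 \<le> real n" using real_arch_simple by blast
    then show "f x < f y" using \<open>x < y\<close> by (intro *[of x y n]) linarith+
  qed
qed

lemma continuous_on_if_slope_bounded:
  fixes f :: "real \<Rightarrow> real"
  assumes "strict_mono f" "strict_mono (\<lambda>x. c * x - f x)"
  shows "continuous_on UNIV f"
proof -
  have "\<bar>f y - f x\<bar> \<le> \<bar>c\<bar> * \<bar>y - x\<bar>" if "x < y" for x y
  proof -
    have "f x < f y" "c * x - f x < c * y - f y" using assms that by (auto simp: strict_mono_def)
    then have "\<bar>f y - f x\<bar> \<le> c * (y - x)" by (simp add: algebra_simps)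
    also have "\<dots> \<le> \<bar>c\<bar> * \<bar>y - x\<bar>" by (simp add: abs_mult[symmetric])
    finally show ?thesis .
  qed
  then have "\<bar>f y - f x\<bar> \<le> \<bar>c\<bar> * \<bar>y - x\<bar>" for x y
    by (metis abs_minus_commute abs_zero diff_self linorder_less_linear mult_zero_right order_refl)
  then have "\<bar>c\<bar>-lipschitz_on UNIV f"
    by (intro lipschitz_onI) (auto simp: dist_real_def)
  then show ?thesis by (rule lipschitz_on_continuous_on)
qed



section \<open>The padding map\<close>

text \<open>
  Picard iteration for the functional equation of the padding map on \<open>[0, 1]\<close>: a leading ternary
  digit \<open>0\<close> is replaced by the digits \<open>0 2\<close> (scale by \<open>1/9\<close>, add \<open>2/9\<close>), a leading digit \<open>2\<close> is kept, and
  the middle third is mapped affinely. The iteration contracts distances by \<open>1/3\<close>.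
\<close>

primrec pad_approx :: "nat \<Rightarrow> real \<Rightarrow> real" where
  "pad_approx 0 y = 1"
| "pad_approx (Suc n) y =
    (if 3 * y \<le> 1 then pad_approx n (3 * y) / 9 + 2 / 9
     else if 3 * y \<le> 2 then 5 / 4 * y - 1 / 12
     else pad_approx n (3 * y - 2) / 3 + 2 / 3)"

definition pad_unit :: "real \<Rightarrow> real" where
  "pad_unit y = lim (\<lambda>n. pad_approx n y)"

lemma pad_approx_range: "1 / 4 \<le> pad_approx n y \<and> pad_approx n y \<le> 1"
proof (induction n arbitrary: y)
  case (Suc n)
  have "1 / 4 \<le> pad_approx n (3 * y)" "pad_approx n (3 * y) \<le> 1"
    "1 / 4 \<le> pad_approx n (3 * y - 2)" "pad_approx n (3 * y - 2) \<le> 1"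
    using Suc by blast+
  then show ?case unfolding pad_approx.simps by auto
qed simp

lemma pad_approx_step: "\<bar>pad_approx (Suc n) y - pad_approx n y\<bar> \<le> (1 / 3) ^ n"
proof (induction n arbitrary: y)
  case 0
  then show ?case using pad_approx_range[of 1 y] pad_approx_range[of 0 y] by simp
next
  case (Suc n)
  have "pad_approx (Suc (Suc n)) y - pad_approx (Suc n) y =
    (if 3 * y \<le> 1 then (pad_approx (Suc n) (3 * y) - pad_approx n (3 * y)) / 9
     else if 3 * y \<le> 2 then 0
     else (pad_approx (Suc n) (3 * y - 2) - pad_approx n (3 * y - 2)) / 3)"
    unfolding pad_approx.simps(2)[of "Suc n" y] pad_approx.simps(2)[of n y]
    by (auto simp del: pad_approx.simps simp: diff_divide_distrib)
  then show ?case using Suc[of "3 * y"] Suc[of "3 * y - 2"]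
    by (auto simp del: pad_approx.simps)
qed

lemma pad_approx_tendsto: "(\<lambda>n. pad_approx n y) \<longlonglongrightarrow> pad_unit y"
proof -
  have "summable (\<lambda>n. pad_approx (Suc n) y - pad_approx n y)"
  proof (rule summable_comparison_test')
    show "summable (\<lambda>n. (1 / 3 :: real) ^ n)" by (simp add: summable_geometric)
    show "norm (pad_approx (Suc n) y - pad_approx n y) \<le> (1 / 3) ^ n" for n
      using pad_approx_step[of n y] by simp
  qed
  then have "convergent (\<lambda>n. 1 + (\<Sum>i<n. pad_approx (Suc i) y - pad_approx i y))"
    by (intro convergent_add convergent_const) (simp add: summable_iff_convergent)
  moreover have "1 + (\<Sum>i<n. pad_approx (Suc i) y - pad_approx i y) = pad_approx n y" for n
    using sum_lessThan_telescope[of "\<lambda>i. pad_approx i y" n] by (simp del: pad_approx.simps(2))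
  ultimately show ?thesis by (simp add: pad_unit_def convergent_LIMSEQ_iff)
qed

lemma pad_unit_eq:
  "pad_unit y =
    (if 3 * y \<le> 1 then pad_unit (3 * y) / 9 + 2 / 9
     else if 3 * y \<le> 2 then 5 / 4 * y - 1 / 12
     else pad_unit (3 * y - 2) / 3 + 2 / 3)"
proof (rule LIMSEQ_unique[OF LIMSEQ_Suc[OF pad_approx_tendsto[of y]]])
  show "(\<lambda>n. pad_approx (Suc n) y) \<longlonglongrightarrow>
    (if 3 * y \<le> 1 then pad_unit (3 * y) / 9 + 2 / 9
     else if 3 * y \<le> 2 then 5 / 4 * y - 1 / 12
     else pad_unit (3 * y - 2) / 3 + 2 / 3)"
    using pad_approx_tendsto[of "3 * y"] pad_approx_tendsto[of "3 * y - 2"]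
    by (auto intro!: tendsto_eq_intros)
qed

lemma pad_unit_range: "1 / 4 \<le> pad_unit y" "pad_unit y \<le> 1"
  using LIMSEQ_le_const[OF pad_approx_tendsto[of y], of "1 / 4"]
    LIMSEQ_le_const2[OF pad_approx_tendsto[of y], of 1] pad_approx_range by blast+

lemma pad_unit_0: "pad_unit 0 = 1 / 4"
  using pad_unit_eq[of 0] by (simp only: mult_zero_right if_True zero_le_one)

lemma pad_unit_1: "pad_unit 1 = 1"
  using pad_unit_eq[of 1] by (simp split: if_splits)

lemma pad_unit_left: "3 * y \<le> 1 \<Longrightarrow> pad_unit y = pad_unit (3 * y) / 9 + 2 / 9"
  using pad_unit_eq[of y] by simp

lemma pad_unit_mid: "1 \<le> 3 * y \<Longrightarrow> 3 * y \<le> 2 \<Longrightarrow> pad_unit y = 5 / 4 * y - 1 / 12"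
  using pad_unit_eq[of y] pad_unit_1 by (cases "3 * y = 1") auto

lemma pad_unit_right: "2 \<le> 3 * y \<Longrightarrow> pad_unit y = pad_unit (3 * y - 2) / 3 + 2 / 3"
  using pad_unit_eq[of y] pad_unit_0 by (cases "3 * y = 2") auto

text \<open>
  On \<open>[0, 1]\<close> the slopes of this map on small gaps get arbitrarily small, so there is no linear lower
  bound; instead the functional equation is used to magnify the two points until they no longer lie
  in the same outer third.
\<close>

lemma pad_unit_strict_mono:
  assumes "0 \<le> x" "x < y" "y \<le> 1"
  shows "pad_unit x < pad_unit y"
proof -
  have "pad_unit x < pad_unit y" if "0 \<le> x" "x < y" "y \<le> 1" "(1 / 3) ^ n \<le> y - x" for n x y
    using that
  proof (induction n arbitrary: x y)
    case 0
    then have "x = 0" "y = 1" by auto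
    then show ?case by (simp add: pad_unit_0 pad_unit_1)
  next
    case (Suc n)
    have IHl: "3 * y \<le> 1 \<Longrightarrow> pad_unit (3 * x) < pad_unit (3 * y)"
      using Suc.prems by (intro Suc.IH) auto
    have IHr: "3 * x \<ge> 2 \<Longrightarrow> pad_unit (3 * x - 2) < pad_unit (3 * y - 2)"
      using Suc.prems by (intro Suc.IH) auto
    consider "3 * y \<le> 1" | "3 * x \<le> 1" "1 < 3 * y" "3 * y \<le> 2" | "3 * x \<le> 1" "2 < 3 * y"
      | "1 \<le> 3 * x" "3 * y \<le> 2" | "1 \<le> 3 * x" "3 * x < 2" "2 < 3 * y" | "2 \<le> 3 * x"
      by linarith
    then show ?case
    proof cases
      case 1
      then show ?thesis using IHl Suc.prems pad_unit_left[of x] pad_unit_left[of y] by simp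
    next
      case 2
      then show ?thesis using pad_unit_range[of "3 * x"] pad_unit_left[of x] pad_unit_mid[of y] by simp
    next
      case 3
      then show ?thesis
        using pad_unit_range[of "3 * x"] pad_unit_range[of "3 * y - 2"] pad_unit_left[of x] pad_unit_right[of y]
        by simp
    next
      case 4
      then show ?thesis using Suc.prems pad_unit_mid[of x] pad_unit_mid[of y] by simp
    next
      case 5
      then show ?thesis using pad_unit_range[of "3 * y - 2"] pad_unit_mid[of x] pad_unit_right[of y] by simp
    next
      case 6
      then show ?thesis using IHr Suc.prems pad_unit_right[of x] pad_unit_right[of y] by simp
    qed
  qed
  moreover obtain n where "(1 / 3) ^ n \<le> y - x"
    using real_arch_pow_inv[of "y - x" "1 / 3"] assms by (auto intro: less_imp_le)
  ultimately show ?thesis using assms by blast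
qed

text \<open>
  The error term in the induction is halved at each magnification, because the two outer thirds
  contribute \<open>1/9 + 1/3 < 1/2\<close> of it.
\<close>

lemma pad_unit_slope:
  assumes "0 \<le> x" "x \<le> y" "y \<le> 1"
  shows "pad_unit y - pad_unit x \<le> 5 / 4 * (y - x)"
proof -
  have *: "pad_unit y - pad_unit x \<le> 5 / 4 * (y - x) + (1 / 2) ^ n" if "0 \<le> x" "x \<le> y" "y \<le> 1" for n x y
    using that
  proof (induction n arbitrary: x y)
    case 0
    then show ?case using pad_unit_range(1)[of x] pad_unit_range(2)[of y] by (simp add: field_simps)
  next
    case (Suc n)
    define e :: real where "e = (1 / 2) ^ n"
    have e: "e > 0" "(1 / 2) ^ Suc n = e / 2" by (simp_all add: e_def)
    have ll: "pad_unit (3 * v) - pad_unit (3 * u) \<le> 5 / 4 * (3 * v - 3 * u) + e"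
      if "0 \<le> u" "u \<le> v" "3 * v \<le> 1" for u v
      using Suc.IH[of "3 * u" "3 * v"] that by (simp add: e_def)
    have rr: "pad_unit (3 * v - 2) - pad_unit (3 * u - 2) \<le> 5 / 4 * (3 * v - 3 * u) + e"
      if "2 \<le> 3 * u" "u \<le> v" "v \<le> 1" for u v
      using Suc.IH[of "3 * u - 2" "3 * v - 2"] that by (simp add: e_def)
    consider "3 * y \<le> 1" | "3 * x \<le> 1" "1 \<le> 3 * y" "3 * y \<le> 2" | "3 * x \<le> 1" "2 \<le> 3 * y"
      | "1 \<le> 3 * x" "3 * y \<le> 2" | "1 \<le> 3 * x" "3 * x \<le> 2" "2 \<le> 3 * y" | "2 \<le> 3 * x"
      using Suc.prems by linarith
    then have "pad_unit y - pad_unit x \<le> 5 / 4 * (y - x) + e / 2"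
    proof cases
      case 1
      then have "3 * x \<le> 1" using Suc.prems by simp
      then show ?thesis
        using ll[OF _ _ 1, of x] 1 Suc.prems e(1) pad_unit_left[of x] pad_unit_left[of y]
        by (simp add: field_simps)
    next
      case 2
      have "1 - pad_unit (3 * x) \<le> 5 / 4 * (1 - 3 * x) + e"
        using ll[of x "1 / 3"] 2 Suc.prems pad_unit_1 by simp
      then show ?thesis using 2 Suc.prems(2) e(1) pad_unit_left[OF 2(1)] pad_unit_mid[OF 2(2,3)] by (simp add: field_simps)
    next
      case 3
      have "1 - pad_unit (3 * x) \<le> 5 / 4 * (1 - 3 * x) + e"
        using ll[of x "1 / 3"] 3 Suc.prems pad_unit_1 by simp
      moreover have "pad_unit (3 * y - 2) - 1 / 4 \<le> 5 / 4 * (3 * y - 2) + e"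
        using rr[of "2 / 3" y] 3 Suc.prems pad_unit_0 by simp
      ultimately show ?thesis using 3 Suc.prems(2) e(1) pad_unit_left[OF 3(1)] pad_unit_right[OF 3(2)] by (simp add: field_simps)
    next
      case 4
      then have "3 * x \<le> 2" "1 \<le> 3 * y" using Suc.prems by simp_all
      then show ?thesis using 4 Suc.prems(2) e(1) pad_unit_mid[of x] pad_unit_mid[of y]
        by (simp add: field_simps)
    next
      case 5
      have "pad_unit (3 * y - 2) - 1 / 4 \<le> 5 / 4 * (3 * y - 2) + e"
        using rr[of "2 / 3" y] 5 Suc.prems pad_unit_0 by simp
      then show ?thesis using 5 Suc.prems(2) e(1) pad_unit_mid[OF 5(1,2)] pad_unit_right[OF 5(3)] by (simp add: field_simps)
    next
      case 6
      then have "2 \<le> 3 * y" using Suc.prems by simp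
      then show ?thesis
        using rr[OF 6, of y] Suc.prems e(1) pad_unit_right[OF 6] pad_unit_right[of y]
        by (simp add: field_simps)
    qed
    then show ?case unfolding e(2) .
  qed
  have "(\<lambda>n. 5 / 4 * (y - x) + (1 / 2) ^ n) \<longlonglongrightarrow> 5 / 4 * (y - x) + 0"
    by (intro tendsto_intros LIMSEQ_power_zero) simp
  then show ?thesis using *[OF assms] LIMSEQ_le_const by fastforce
qed

text \<open>
  On the gap \<open>[1, 2]\<close> the slope \<open>5/4\<close> is forced by continuity: the left end \<open>0\<close> of a cell has the padded
  expansion \<open>0 2 0 2 ...\<close>, which is \<open>1/4\<close>, so the image of a gap reaches a quarter into the next cell.
\<close>

definition pad :: "real \<Rightarrow> real" where
  "pad x = (let j = of_int \<lfloor>x / 2\<rfloor>; y = x - 2 * j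
            in 2 * j + (if y \<le> 1 then pad_unit y else 5 / 4 * y - 1 / 4))"

lemma pad_shift: "pad (x + 2 * of_int i) = pad x + 2 * of_int i"
proof -
  have "\<lfloor>(x + 2 * of_int i) / 2\<rfloor> = \<lfloor>x / 2\<rfloor> + i"
    by (simp add: add_divide_distrib)
  then show ?thesis by (simp add: pad_def Let_def)
qed

lemma pad_cell: "0 \<le> y \<Longrightarrow> y \<le> 1 \<Longrightarrow> pad y = pad_unit y"
proof -
  assume "0 \<le> y" "y \<le> 1"
  moreover then have "\<lfloor>y / 2\<rfloor> = 0" by linarith
  ultimately show ?thesis by (simp add: pad_def)
qed

lemma pad_gap: "1 \<le> y \<Longrightarrow> y \<le> 2 \<Longrightarrow> pad y = 5 / 4 * y - 1 / 4"
proof -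
  assume y: "1 \<le> y" "y \<le> 2"
  consider "y = 1" | "y = 2" | "1 < y" "y < 2" using y by linarith
  then show ?thesis
  proof cases
    case 1
    then show ?thesis by (simp add: pad_cell pad_unit_1)
  next
    case 2
    then show ?thesis using pad_shift[of 0 1] by (simp add: pad_cell pad_unit_0)
  next
    case 3
    then have "\<lfloor>y / 2\<rfloor> = 0" by linarith
    then show ?thesis using 3 by (simp add: pad_def)
  qed
qed

lemma pad_unit_interval:
  assumes "of_int k \<le> x" "x < y" "y \<le> of_int k + 1"
  shows "pad x < pad y" "pad y - pad x \<le> 5 / 4 * (y - x)"
proof -
  obtain i r where k: "k = 2 * i + r" "r = 0 \<or> r = 1"
    using that[of "k div 2" "k mod 2"] by simp presburger
  define u v where uv: "u = x - 2 * of_int i" "v = y - 2 * of_int i"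
  have r: "of_int r \<le> u" "u < v" "v \<le> of_int r + 1" using assms k(1) by (auto simp: uv)
  have "pad u < pad v \<and> pad v - pad u \<le> 5 / 4 * (v - u)"
    using k(2)
  proof
    assume "r = 0"
    then show ?thesis using r pad_unit_strict_mono[of u v] pad_unit_slope[of u v] by (simp add: pad_cell)
  next
    assume "r = 1"
    then show ?thesis using r by (simp add: pad_gap)
  qed
  moreover have "pad x = pad u + 2 * of_int i" "pad y = pad v + 2 * of_int i"
    using pad_shift[of u i] pad_shift[of v i] by (simp_all add: uv)
  ultimately show "pad x < pad y" "pad y - pad x \<le> 5 / 4 * (y - x)" by (simp_all add: uv)
qed

lemma strict_mono_pad: "strict_mono pad"
  by (rule strict_mono_from_unit_intervals) (rule pad_unit_interval)

lemma continuous_on_pad: "continuous_on UNIV pad"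
proof (rule continuous_on_if_slope_bounded[OF strict_mono_pad])
  show "strict_mono (\<lambda>x. 2 * x - pad x)"
  proof (rule strict_mono_from_unit_intervals)
    fix k :: int and x y :: real
    assume "of_int k \<le> x" "x < y" "y \<le> of_int k + 1"
    then show "2 * x - pad x < 2 * y - pad y" using pad_unit_interval(2)[of k x y] by simp
  qed
qed

lemma pad_third_left: "0 \<le> x \<Longrightarrow> x \<le> 1 \<Longrightarrow> pad (x / 3) = pad x / 9 + 2 / 9"
  using pad_unit_left[of "x / 3"] by (simp add: pad_cell)

text \<open>
  Padding commutes with scaling by \<open>1/3\<close> except on the cell \<open>[0, 1]\<close>, where an additional digit
  appears; these two rules are all that is needed about \<open>pad\<close> on the small scales.
\<close>

lemma pad_third_right: "1 \<le> x \<Longrightarrow> x \<le> 3 \<Longrightarrow> pad (x / 3) = pad x / 3"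
proof -
  assume x: "1 \<le> x" "x \<le> 3"
  show ?thesis
  proof (cases "x \<le> 2")
    case True
    then show ?thesis using x pad_unit_mid[of "x / 3"] by (simp add: pad_cell pad_gap)
  next
    case False
    then show ?thesis using x pad_unit_right[of "x / 3"] pad_shift[of "x - 2" 1] by (simp add: pad_cell)
  qed
qed

section \<open>Removing the leading digit, and the lifted generator\<close>

text \<open>
  The cell \<open>[0, 1]\<close> is magnified to \<open>[0, 3]\<close>. To compensate, the part \<open>[2, 5]\<close> (two cells and the gap
  between them) is shrunk to the cell \<open>[4, 5]\<close>; the gap \<open>[1, 2]\<close> is moved to \<open>[3, 4]\<close> and \<open>[5, 6]\<close> is fixed.
  Each piece respects the pattern of cells and gaps, so nothing changes about relative positions.
\<close>

definition stretch :: "real \<Rightarrow> real" where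
  "stretch x = (let j = of_int \<lfloor>x / 6\<rfloor>; y = x - 6 * j
     in 6 * j + (if y \<le> 1 then 3 * y else if y \<le> 2 then y + 2 else if y \<le> 5 then y / 3 + 10 / 3 else y))"

lemma stretch_shift: "stretch (x + 6 * of_int i) = stretch x + 6 * of_int i"
proof -
  have "\<lfloor>(x + 6 * of_int i) / 6\<rfloor> = \<lfloor>x / 6\<rfloor> + i"
    by (simp add: add_divide_distrib)
  then show ?thesis by (simp add: stretch_def Let_def)
qed

lemma stretch_period:
  assumes "0 \<le> y" "y \<le> 6"
  shows "stretch y = (if y \<le> 1 then 3 * y else if y \<le> 2 then y + 2 else if y \<le> 5 then y / 3 + 10 / 3 else y)"
proof (cases "y = 6")
  case True
  then show ?thesis using stretch_shift[of 0 1] by (simp add: stretch_def)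
next
  case False
  then have "\<lfloor>y / 6\<rfloor> = 0" using assms by linarith
  then show ?thesis by (simp add: stretch_def)
qed

lemma stretch_unit_interval:
  assumes "of_int k \<le> x" "x < y" "y \<le> of_int k + 1"
  shows "stretch x < stretch y" "stretch y - stretch x \<le> 3 * (y - x)"
proof -
  define i r where "i = k div 6" and "r = k mod 6"
  then have k: "k = 6 * i + r" "0 \<le> r" "r < 6" by simp_all
  define u v where uv: "u = x - 6 * of_int i" "v = y - 6 * of_int i"
  have r: "of_int r \<le> u" "u < v" "v \<le> of_int r + 1" using assms k(1) by (auto simp: uv)
  have "r = 0 \<or> r = 1 \<or> r = 2 \<or> r = 3 \<or> r = 4 \<or> r = 5" using k by presburger
  then have "stretch u < stretch v \<and> stretch v - stretch u \<le> 3 * (v - u)"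
    using r by (elim disjE) (simp_all add: stretch_period)
  moreover have "stretch x = stretch u + 6 * of_int i" "stretch y = stretch v + 6 * of_int i"
    using stretch_shift[of u i] stretch_shift[of v i] by (simp_all add: uv)
  ultimately show "stretch x < stretch y" "stretch y - stretch x \<le> 3 * (y - x)" by (simp_all add: uv)
qed

lemma strict_mono_stretch: "strict_mono stretch"
  by (rule strict_mono_from_unit_intervals) (rule stretch_unit_interval)

lemma continuous_on_stretch: "continuous_on UNIV stretch"
proof (rule continuous_on_if_slope_bounded[OF strict_mono_stretch])
  show "strict_mono (\<lambda>x. 4 * x - stretch x)"
  proof (rule strict_mono_from_unit_intervals)
    fix k :: int and x y :: real
    assume "of_int k \<le> x" "x < y" "y \<le> of_int k + 1"
    then show "4 * x - stretch x < 4 * y - stretch y" using stretch_unit_interval(2)[of k x y] by simp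
  qed
qed

definition lift :: "real \<Rightarrow> real" where
  "lift x = stretch (pad x)"

lemma lift_shift: "lift (x + 6 * of_int i) = lift x + 6 * of_int i"
  using pad_shift[of x "3 * i"] stretch_shift[of "pad x" i] by (simp add: lift_def)

lemma strict_mono_lift: "strict_mono lift"
  using strict_mono_pad strict_mono_stretch by (auto simp: strict_mono_def lift_def)

lemma continuous_on_lift: "continuous_on UNIV lift"
  unfolding lift_def
  by (rule continuous_on_compose2[OF continuous_on_stretch continuous_on_pad]) simp

lemma lift_intermediate:
  assumes "a \<le> b" "lift a \<le> y" "y \<le> lift b"
  shows "\<exists>x. a \<le> x \<and> x \<le> b \<and> lift x = y"
  using IVT'[of lift a y b] assms continuous_on_subset[OF continuous_on_lift] by blast

lemma surj_lift: "surj lift"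
  unfolding surj_def
proof
  fix y
  define i :: int where "i = \<lfloor>(y - lift 0) / 6\<rfloor>"
  have "lift (0 + 6 * of_int i) \<le> y" "y \<le> lift (0 + 6 * of_int (i + 1))"
    using floor_correct[of "(y - lift 0) / 6"] unfolding lift_shift i_def by (simp_all add: field_simps)
  then show "\<exists>x. y = lift x"
    using lift_intermediate[of "0 + 6 * of_int i" "0 + 6 * of_int (i + 1)" y] by auto
qed

section \<open>Padding acts on gap positions\<close>

lemma stretch_same_type: "stretch x \<approx>\<^sub>g x"
proof -
  define i where "i = \<lfloor>x / 6\<rfloor>"
  define y where "y = x - 6 * of_int i"
  have y: "0 \<le> y" "y < 6" unfolding y_def i_def by linarith+
  have "stretch y \<approx>\<^sub>g y"
  proof -
    consider "y \<le> 1" | "1 < y" "y \<le> 2" | "2 < y" "y \<le> 5" | "5 < y" by linarith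
    then show ?thesis
    proof cases
      case 1
      then show ?thesis using y same_type_third[of "3 * y"] by (simp add: stretch_period same_type_sym)
    next
      case 2
      then show ?thesis using y same_type_shift[of y 1] by (simp add: stretch_period)
    next
      case 3
      have "stretch y = (y - 2) / 3 + 2 * of_int 2" using 3 y by (simp add: stretch_period diff_divide_distrib)
      also have "\<dots> \<approx>\<^sub>g (y - 2) / 3" by (rule same_type_shift)
      also have "(y - 2) / 3 \<approx>\<^sub>g y - 2" using 3 by (intro same_type_third) auto
      also have "y - 2 \<approx>\<^sub>g y" using same_type_shift[of y "-1"] by simp
      finally show ?thesis .
    next
      case 4
      then show ?thesis using y by (simp add: stretch_period same_type_refl)
    qed
  qed
  have "stretch x = stretch y + 2 * of_int (3 * i)"
    using stretch_shift[of y i] by (simp add: y_def)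
  also have "\<dots> \<approx>\<^sub>g stretch y" by (rule same_type_shift)
  also have "stretch y \<approx>\<^sub>g y" by fact
  also have "y \<approx>\<^sub>g x" using same_type_shift[of x "- (3 * i)"] by (simp add: y_def same_type_sym)
  finally show ?thesis .
qed

text \<open>
  By self-similarity it suffices to know \<open>pad\<close> on the gap \<open>[1, 2]\<close>.
\<close>

lemma pad_in_gap_type: "in_gap x t \<Longrightarrow> pad x \<approx>\<^sub>g pad (1 + t)"
proof (induction rule: in_gap.induct)
  case (outer j x)
  have "pad x = pad (1 + (x - 2 * of_int j - 1)) + 2 * of_int j"
    using pad_shift[of "x - 2 * of_int j" j] by simp
  then show ?case using same_type_shift by presburger
next
  case (inner j x t)
  define y where "y = 3 * (x - 2 * of_int j)"
  have y: "0 \<le> y" "y \<le> 3" "x = y / 3 + 2 * of_int j" using inner.hyps by (simp_all add: y_def field_simps)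
  have "pad x \<approx>\<^sub>g pad (y / 3)" using pad_shift[of "y / 3" j] same_type_shift y(3) by presburger
  also have "pad (y / 3) \<approx>\<^sub>g pad y"
  proof (cases "1 \<le> y")
    case True
    have "pad 1 \<le> pad y" "pad y \<le> pad 3"
      using True y strict_mono_pad by (simp_all add: strict_mono_less_eq)
    moreover have "pad 1 = 1" "pad 3 = 3"
      using pad_gap[of 1] pad_shift[of 1 1] by simp_all
    ultimately show ?thesis
      using True y same_type_third[of "pad y"] by (simp add: pad_third_right)
  next
    case False
    then have r: "0 \<le> pad y" "pad y \<le> 1" using y pad_unit_range[of y] by (simp_all add: pad_cell)
    have "pad (y / 3) = (pad y + 2 * of_int 1) / 3 / 3" using False y by (simp add: pad_third_left)
    also have "\<dots> \<approx>\<^sub>g (pad y + 2 * of_int 1) / 3" using r by (intro same_type_third) auto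
    also have "\<dots> \<approx>\<^sub>g pad y + 2 * of_int 1" using r by (intro same_type_third) auto
    also have "\<dots> \<approx>\<^sub>g pad y" by (rule same_type_shift)
    finally show ?thesis .
  qed
  also have "pad y \<approx>\<^sub>g pad (1 + t)" using inner.IH unfolding y_def .
  finally show ?case .
qed

text \<open>
  Padding leaves the Cantor set invariant.
\<close>

lemma in_gap_if_pad_in_gap: "in_gap y s \<Longrightarrow> y = pad x \<Longrightarrow> \<exists>t. in_gap x t"
proof (induction arbitrary: x rule: in_gap.induct)
  case (outer j y)
  define u where "u = x - 2 * of_int j"
  have "pad u = y - 2 * of_int j" using outer pad_shift[of u j] by (simp add: u_def)
  then have "pad 1 < pad u" "pad u < pad 2" using outer by (simp_all add: pad_gap)
  then have "1 < u" "u < 2" using strict_mono_pad by (simp_all add: strict_mono_less)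
  then show ?case using in_gap.outer[of j x] by (auto simp: u_def)
next
  case (inner j y s)
  define u where "u = x - 2 * of_int j"
  have pu: "pad u = y - 2 * of_int j" using inner.prems pad_shift[of u j] by (simp add: u_def)
  have "pad (-1) = -1" "pad 1 = 1" using pad_shift[of 1 "-1"] by (simp_all add: pad_gap)
  then have "pad (-1) < pad u" "pad u \<le> pad 1" using inner.hyps pu by simp_all
  then have u: "-1 < u" "u \<le> 1" using strict_mono_pad by (simp_all add: strict_mono_less strict_mono_less_eq)
  show ?case
  proof (cases "u < 0")
    case True
    then show ?thesis using in_gap.outer[of "j - 1" x] u by (auto simp: u_def)
  next
    case False
    define v where "v = 3 * u"
    have v: "0 \<le> v" "v \<le> 3" "u = v / 3" using False u by (simp_all add: v_def)
    have "\<exists>t. in_gap v t"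
    proof (cases "1 \<le> v")
      case True
      then have "3 * (y - 2 * of_int j) = pad v" using pu v by (simp add: pad_third_right)
      then show ?thesis by (rule inner.IH)
    next
      case False
      then have "3 * (y - 2 * of_int j) = pad ((v + 2 * of_int 1) / 3)"
        using pu v pad_third_right[of "v + 2 * of_int 1"] pad_shift[of v 1] by (simp add: pad_third_left)
      then have "\<exists>t. in_gap ((v + 2 * of_int 1) / 3) t" by (rule inner.IH)
      then show ?thesis using in_gap_third_iff[of "v + 2 * of_int 1"] in_gap_shift_iff[of v 1] False v by simp
    qed
    then show ?thesis
      using in_gap_inner_iff[of j x] False u by (auto simp: v_def u_def)
  qed
qed

text \<open>
  The determinism behind trapping: the type of the image depends on the type alone.
\<close>

lemma pad_same_type:
  assumes "x \<approx>\<^sub>g y"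
  shows "pad x \<approx>\<^sub>g pad y"
proof (cases "\<exists>t. in_gap x t")
  case True
  then obtain t where "in_gap x t" "in_gap y t" using assms by (auto simp: same_type_def)
  then show ?thesis by (intro same_type_trans[OF pad_in_gap_type same_type_sym[OF pad_in_gap_type]])
next
  case False
  moreover then have "\<nexists>t. in_gap y t" using assms by (simp add: same_type_def)
  ultimately have "\<not> in_gap (pad x) t" "\<not> in_gap (pad y) t" for t
    using in_gap_if_pad_in_gap[of "pad x" t x] in_gap_if_pad_in_gap[of "pad y" t y] by auto
  then show ?thesis by (simp add: same_type_def)
qed

lemma lift_same_type: "x \<approx>\<^sub>g y \<Longrightarrow> lift x \<approx>\<^sub>g pad y"
  unfolding lift_def by (rule same_type_trans[OF stretch_same_type pad_same_type])

lemma pad_funpow_same_type: "x \<approx>\<^sub>g y \<Longrightarrow> (pad ^^ n) x \<approx>\<^sub>g (pad ^^ n) y"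
  by (induction n) (auto intro: pad_same_type)

lemma pad_funpow_dust: "x \<in> dust \<Longrightarrow> (pad ^^ n) x \<in> dust"
proof (induction n)
  case (Suc n)
  have "1 \<in> dust" using int_in_dust[of 1] by simp
  then have "(pad ^^ n) x \<approx>\<^sub>g 1" using Suc by (simp add: same_type_def dust_def)
  then have "pad ((pad ^^ n) x) \<approx>\<^sub>g pad 1" by (rule pad_same_type)
  then show ?case using \<open>1 \<in> dust\<close> by (simp add: pad_gap dust_same_type)
qed simp

text \<open>
  As long as the images avoid the Cantor set, each stays inside one gap, where its relative length
  is multiplied by at least \<open>5/4\<close>; but a relative length never exceeds \<open>1\<close>.
\<close>

lemma gap_interval_growth:
  assumes "t1 < t2" "{t1<..<t2} \<subseteq> {0<..<1}"
    and "\<And>k x. k \<le> n \<Longrightarrow> x \<in> {t1<..<t2} \<Longrightarrow> (pad ^^ k) (1 + x) \<notin> dust"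
  shows "(5 / 4) ^ n * (t2 - t1) \<le> 1"
  using assms
proof (induction n arbitrary: t1 t2)
  case 0
  then show ?case by (simp add: greaterThanLessThan_subseteq_greaterThanLessThan)
next
  case (Suc n)
  have t: "0 \<le> t1" "t2 \<le> 1"
    using Suc.prems by (simp_all add: greaterThanLessThan_subseteq_greaterThanLessThan)
  define a b where ab: "a = 1 + 5 / 4 * t1" "b = 1 + 5 / 4 * t2"
  have pre: "\<exists>x\<in>{t1<..<t2}. y = pad (1 + x)" if "y \<in> {a<..<b}" for y
  proof
    show "4 / 5 * (y - 1) \<in> {t1<..<t2}" using that by (auto simp: ab)
    then show "y = pad (1 + 4 / 5 * (y - 1))" using t by (simp add: pad_gap field_simps)
  qed
  have "y \<notin> dust" if y: "y \<in> {a<..<b}" for y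
    using pre[OF y] Suc.prems(3)[of 1] by auto
  then have "{a<..<b} \<inter> dust = {}" by blast
  moreover have "a < b" using Suc.prems(1) by (simp add: ab)
  ultimately obtain m q where m: "m \<ge> 1" and mq: "\<And>y. y \<in> {a<..<b} \<Longrightarrow> in_gap y (m * y + q)"
    using gap_affine by blast
  have inv: "(s - q) / m \<in> {a<..<b} \<and> in_gap ((s - q) / m) s" if "s \<in> {m * a + q<..<m * b + q}" for s
  proof -
    have *: "(s - q) / m \<in> {a<..<b}" using that m by (auto simp: field_simps)
    then show ?thesis using mq[OF *] m by simp
  qed
  have "(5 / 4) ^ n * (5 / 4 * (t2 - t1)) \<le> (5 / 4) ^ n * ((m * b + q) - (m * a + q))"
  proof (intro mult_left_mono)
    have "1 * (b - a) \<le> m * (b - a)" using m \<open>a < b\<close> by (intro mult_right_mono) auto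
    then show "5 / 4 * (t2 - t1) \<le> (m * b + q) - (m * a + q)" by (simp add: ab field_simps)
  qed simp
  also have "\<dots> \<le> 1"
  proof (rule Suc.IH)
    show "m * a + q < m * b + q" using \<open>a < b\<close> m by simp
    show sub: "{m * a + q<..<m * b + q} \<subseteq> {0<..<1}" using inv in_gap_range by fastforce
    fix k s assume k: "k \<le> n" and s: "s \<in> {m * a + q<..<m * b + q}"
    define y where "y = (s - q) / m"
    have y: "y \<in> {a<..<b}" "in_gap y s" using inv[OF s] by (auto simp: y_def)
    have "in_gap (1 + s) s" using in_gap.outer[of 0 "1 + s"] sub s by auto
    then have "1 + s \<approx>\<^sub>g y" using y(2) in_gap_unique by (auto simp: same_type_def)
    then have "(pad ^^ k) (1 + s) \<approx>\<^sub>g (pad ^^ k) y" by (rule pad_funpow_same_type)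
    moreover obtain x where "x \<in> {t1<..<t2}" "y = pad (1 + x)" using pre[OF y(1)] by blast
    moreover from this have "(pad ^^ k) y \<notin> dust"
      using Suc.prems(3)[of "Suc k" x] k by (simp add: funpow_swap1)
    ultimately show "(pad ^^ k) (1 + s) \<notin> dust" using dust_same_type by blast
  qed
  finally show ?case by (simp only: power_Suc mult_ac)
qed

lemma pad_orbit_hits_dust:
  assumes "a < b"
  shows "\<exists>x\<in>{a<..<b}. \<exists>n. (pad ^^ n) x \<in> dust"
proof (rule ccontr)
  assume no: "\<not> (\<exists>x\<in>{a<..<b}. \<exists>n. (pad ^^ n) x \<in> dust)"
  then have "{a<..<b} \<inter> dust = {}" by (metis disjoint_iff funpow_0)
  then obtain m q where m: "m \<ge> 1" and mq: "\<And>y. y \<in> {a<..<b} \<Longrightarrow> in_gap y (m * y + q)"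
    using gap_affine[OF assms] by blast
  have inv: "(s - q) / m \<in> {a<..<b} \<and> in_gap ((s - q) / m) s" if "s \<in> {m * a + q<..<m * b + q}" for s
  proof -
    have *: "(s - q) / m \<in> {a<..<b}" using that m by (auto simp: field_simps)
    then show ?thesis using mq[OF *] m by simp
  qed
  have bound: "(5 / 4) ^ n * ((m * b + q) - (m * a + q)) \<le> 1" for n
  proof (rule gap_interval_growth)
    show "m * a + q < m * b + q" using \<open>a < b\<close> m by simp
    show sub: "{m * a + q<..<m * b + q} \<subseteq> {0<..<1}" using inv in_gap_range by fastforce
    fix k s assume s: "s \<in> {m * a + q<..<m * b + q}"
    have "in_gap (1 + s) s" using in_gap.outer[of 0 "1 + s"] sub s by auto
    then have "1 + s \<approx>\<^sub>g (s - q) / m" using inv[OF s] in_gap_unique by (auto simp: same_type_def)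
    then have "(pad ^^ k) (1 + s) \<approx>\<^sub>g (pad ^^ k) ((s - q) / m)" by (rule pad_funpow_same_type)
    then show "(pad ^^ k) (1 + s) \<notin> dust" using inv[OF s] no dust_same_type by blast
  qed
  have pos: "m * b + q - (m * a + q) > 0" using \<open>a < b\<close> m by simp
  obtain n where "1 / (m * b + q - (m * a + q)) < (5 / 4) ^ n"
    using real_arch_pow[of "5 / 4"] by auto
  then show False using bound[of n] pos by (simp add: divide_less_eq)
qed

section \<open>Orbits and growth of intervals on the line\<close>

text \<open>
  Using all even translations, instead of three of them, adds only translates by multiples of \<open>6\<close>,
  which are invisible on the circle, and keeps
  arithmetic modulo \<open>6\<close> out of the analysis on the line.
\<close>

definition branches :: "(real \<Rightarrow> real) set" where
  "branches = range (\<lambda>(j::int) x. lift (x + 2 * of_int j))"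

abbreviation spread :: "real set \<Rightarrow> real set" where
  "spread \<equiv> hutchinson branches"

lemma in_spread_iff: "y \<in> spread A \<longleftrightarrow> (\<exists>x\<in>A. \<exists>j::int. y = lift (x + 2 * of_int j))"
  by (auto simp: hutchinson_def branches_def)

text \<open>
  Translations and \<open>stretch\<close> do not affect types, so all points of the \<open>n\<close>-th image set have the type
  that \<open>n\<close> applications of \<open>pad\<close> produce.
\<close>

lemma spread_orbit_type: "y \<in> (spread ^^ n) {x} \<Longrightarrow> y \<approx>\<^sub>g (pad ^^ n) x"
proof (induction n arbitrary: y)
  case 0
  then show ?case by (simp add: same_type_refl)
next
  case (Suc n)
  then obtain z and j :: int where z: "z \<in> (spread ^^ n) {x}" "y = lift (z + 2 * of_int j)"
    by (auto simp: in_spread_iff)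
  have "lift (z + 2 * of_int j) \<approx>\<^sub>g pad z" by (rule lift_same_type[OF same_type_shift])
  also have "pad z \<approx>\<^sub>g pad ((pad ^^ n) x)" using Suc.IH[OF z(1)] by (rule pad_same_type)
  finally show ?case using z(2) by simp
qed

lemma spread_orbit_trapped:
  assumes "a < b"
  shows "\<exists>x\<in>{a<..<b}. \<exists>N. \<forall>n\<ge>N. (spread ^^ n) {x} \<subseteq> dust"
proof -
  obtain x N where x: "x \<in> {a<..<b}" "(pad ^^ N) x \<in> dust"
    using pad_orbit_hits_dust[OF assms] by blast
  have "(spread ^^ n) {x} \<subseteq> dust" if "n \<ge> N" for n
  proof
    fix y assume "y \<in> (spread ^^ n) {x}"
    then have "y \<approx>\<^sub>g (pad ^^ n) x" by (rule spread_orbit_type)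
    moreover have "(pad ^^ n) x = (pad ^^ (n - N)) ((pad ^^ N) x)"
      using that by (metis comp_apply funpow_add le_add_diff_inverse2)
    ultimately show "y \<in> dust" using pad_funpow_dust[OF x(2)] dust_same_type by metis
  qed
  then show ?thesis using x(1) by blast
qed

definition grows_to :: "real set \<Rightarrow> real set \<Rightarrow> bool" where
  "grows_to A B \<longleftrightarrow> (\<exists>n. B \<subseteq> (spread ^^ n) A)"

lemma spread_mono: "A \<subseteq> B \<Longrightarrow> spread A \<subseteq> spread B"
  by (auto simp: hutchinson_def)

lemma grows_to_subset: "B \<subseteq> A \<Longrightarrow> grows_to A B"
  unfolding grows_to_def by (metis funpow_0)

lemma grows_to_trans [trans]:
  assumes "grows_to A B" "grows_to B C"
  shows "grows_to A C"
proof -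
  obtain m n where mn: "B \<subseteq> (spread ^^ m) A" "C \<subseteq> (spread ^^ n) B"
    using assms by (auto simp: grows_to_def)
  have "(spread ^^ n) B \<subseteq> (spread ^^ n) ((spread ^^ m) A)"
    using mn(1) by (induction n) (auto dest: spread_mono)
  then have "C \<subseteq> (spread ^^ (n + m)) A" using mn(2) by (simp add: funpow_add)
  then show ?thesis unfolding grows_to_def ..
qed

lemma grows_to_spread: "B \<subseteq> spread A \<Longrightarrow> grows_to A B"
  unfolding grows_to_def by (rule exI[of _ 1]) simp

lemma grows_to_lift_interval: "grows_to {a<..<b} {(lift ^^ n) a<..<(lift ^^ n) b}"
proof (induction n)
  case 0
  show ?case by (simp add: grows_to_subset)
next
  case (Suc n)
  define u v where "u = (lift ^^ n) a" and "v = (lift ^^ n) b"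
  have "{lift u<..<lift v} \<subseteq> spread {u<..<v}"
  proof
    fix y assume y: "y \<in> {lift u<..<lift v}"
    then have "lift u < lift v" by simp
    then have "u < v" by (simp add: strict_mono_less[OF strict_mono_lift])
    then obtain x where x: "u \<le> x" "x \<le> v" "lift x = y"
      using lift_intermediate[of u v y] y by auto
    then have "x \<noteq> u" "x \<noteq> v" using y by auto
    then have "x \<in> {u<..<v}" "y = lift (x + 2 * of_int 0)" using x by auto
    then show "y \<in> spread {u<..<v}" unfolding in_spread_iff by blast
  qed
  then have "grows_to {a<..<b} {lift u<..<lift v}"
    by (intro grows_to_trans[OF Suc[folded u_def v_def]] grows_to_spread)
  then show ?case by (simp add: u_def v_def)
qed

text \<open>
  \<open>gap_point ds\<close> maps \<open>[1, 2]\<close> onto the closure of the gap with address \<open>ds\<close> in \<open>[0, 1]\<close>, where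
  \<open>False\<close> stands for the ternary digit \<open>0\<close> and \<open>True\<close> for the digit \<open>2\<close>. The empty address is the
  middle third.
\<close>

primrec gap_point :: "bool list \<Rightarrow> real \<Rightarrow> real" where
  "gap_point [] x = x / 3"
| "gap_point (d # ds) x = (gap_point ds x + (if d then 2 else 0)) / 3"

primrec pad_address :: "bool list \<Rightarrow> bool list" where
  "pad_address [] = []"
| "pad_address (d # ds) = (if d then True # pad_address ds else False # True # pad_address ds)"

lemma gap_point_range: "0 \<le> x \<Longrightarrow> x \<le> 3 \<Longrightarrow> 0 \<le> gap_point ds x \<and> gap_point ds x \<le> 1"
  by (induction ds) auto

lemma pad_gap_point:
  assumes "1 \<le> x" "x \<le> 2"
  shows "pad (gap_point ds x) = gap_point (pad_address ds) (pad x)"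
proof (induction ds)
  case Nil
  then show ?case using assms by (simp add: pad_third_right)
next
  case (Cons d ds)
  define y where "y = gap_point ds x"
  have y: "0 \<le> y" "y \<le> 1" using gap_point_range[of x ds] assms by (auto simp: y_def)
  show ?case
  proof (cases d)
    case True
    then show ?thesis
      using y Cons pad_third_right[of "y + 2"] pad_shift[of y 1] by (simp add: y_def)
  next
    case False
    then show ?thesis using y Cons pad_third_left[of y] by (simp add: y_def)
  qed
qed

text \<open>
  The gap with address \<open>ds\<close>, in whichever cell, can be enlarged to one of the gaps of length \<open>1\<close>.
\<close>

definition opens :: "bool list \<Rightarrow> bool" where
  "opens ds \<longleftrightarrow> (\<forall>i::int. \<exists>j::int. grows_to ((\<lambda>x. gap_point ds x + 2 * of_int i) ` {1..2}) {1 + 2 * of_int j..2 + 2 * of_int j})"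

text \<open>
  The translation back to \<open>[0, 1]\<close> is used before \<open>lift\<close>, since \<open>stretch\<close> removes the leading digit
  only there.
\<close>

lemma spread_gap:
  fixes i :: int
  shows "(\<lambda>x. 3 * gap_point (pad_address ds) x) ` {1..2} \<subseteq> spread ((\<lambda>x. gap_point ds x + 2 * of_int i) ` {1..2})"
proof
  fix y assume "y \<in> (\<lambda>x. 3 * gap_point (pad_address ds) x) ` {1..2}"
  then obtain x where x: "1 \<le> x" "x \<le> 2" "y = 3 * gap_point (pad_address ds) x" by auto
  \<comment> \<open>the preimage of \<open>x\<close> under \<open>pad\<close>, which has slope \<open>5/4\<close> on \<open>[1, 2]\<close>\<close>
  define w where "w = 4 / 5 * x + 1 / 5"
  have w: "1 \<le> w" "w \<le> 2" "pad w = x" using x by (auto simp: w_def pad_gap field_simps)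
  have "lift (gap_point ds w) = y"
    using w x gap_point_range[of x "pad_address ds"]
    by (simp add: lift_def pad_gap_point stretch_period)
  then have "y = lift ((gap_point ds w + 2 * of_int i) + 2 * of_int (- i))" by simp
  moreover have "gap_point ds w + 2 * of_int i \<in> (\<lambda>x. gap_point ds x + 2 * of_int i) ` {1..2}"
    using w by (intro imageI) simp
  ultimately show "y \<in> spread ((\<lambda>x. gap_point ds x + 2 * of_int i) ` {1..2})"
    unfolding in_spread_iff by blast
qed

lemma opens_Nil: "opens []"
  unfolding opens_def
proof
  fix i :: int
  have "{1 + 2 * of_int 0..2 + 2 * of_int 0} \<subseteq> spread ((\<lambda>x. gap_point [] x + 2 * of_int i) ` {1..2})"
    using spread_gap[of "[]" i] by simp
  then show "\<exists>j::int. grows_to ((\<lambda>x. gap_point [] x + 2 * of_int i) ` {1..2}) {1 + 2 * of_int j..2 + 2 * of_int j}"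
    using grows_to_spread by blast
qed

lemma opens_step:
  assumes "pad_address ds = d # es" "opens es"
  shows "opens ds"
  unfolding opens_def
proof
  fix i :: int
  define c :: int where "c = (if d then 1 else 0)"
  obtain j :: int where j: "grows_to ((\<lambda>x. gap_point es x + 2 * of_int c) ` {1..2}) {1 + 2 * of_int j..2 + 2 * of_int j}"
    using assms(2) unfolding opens_def by blast
  have eq: "(\<lambda>x. 3 * gap_point (pad_address ds) x) = (\<lambda>x. gap_point es x + 2 * of_int c)"
    using assms(1) by (auto simp: c_def)
  have "grows_to ((\<lambda>x. gap_point ds x + 2 * of_int i) ` {1..2}) ((\<lambda>x. gap_point es x + 2 * of_int c) ` {1..2})"
    using grows_to_spread[OF spread_gap[of ds i]] unfolding eq .
  then show "\<exists>j::int. grows_to ((\<lambda>x. gap_point ds x + 2 * of_int i) ` {1..2}) {1 + 2 * of_int j..2 + 2 * of_int j}"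
    using j grows_to_trans by blast
qed

lemma pad_address_append: "pad_address (xs @ ys) = pad_address xs @ pad_address ys"
  by (induction xs) auto

lemma pad_address_replicate: "pad_address (replicate k True) = replicate k True"
  by (induction k) auto

text \<open>
  Each step pads the whole address before the leading digit is removed. Quantifying over the number
  \<open>k\<close> of paddings makes a structural induction possible: removing a leading \<open>0\<close> leaves behind only
  digits \<open>2\<close> in front of a padded version of the tail, and leading digits \<open>2\<close> are not multiplied by
  padding.
\<close>

lemma opens_padded: "opens ((pad_address ^^ k) ds)"
proof (induction ds arbitrary: k)
  case Nil
  have "(pad_address ^^ k) [] = []" by (induction k) auto
  then show ?case by (simp add: opens_Nil)
next
  case (Cons d ds)
  have ones: "opens (replicate a True @ (pad_address ^^ k) ds)" for a k
  proof (induction a arbitrary: k)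
    case 0
    then show ?case using Cons by simp
  next
    case (Suc a)
    have "pad_address (replicate (Suc a) True @ (pad_address ^^ k) ds)
      = True # (replicate a True @ (pad_address ^^ Suc k) ds)"
      by (simp add: pad_address_append pad_address_replicate)
    then show ?case using Suc by (rule opens_step)
  qed
  show ?case
  proof (cases d)
    case True
    have "(pad_address ^^ k) (d # ds) = replicate 1 True @ (pad_address ^^ k) ds"
      using True by (induction k) auto
    then show ?thesis using ones[of 1 k] by simp
  next
    case False
    have *: "(pad_address ^^ k) (d # ds) = False # replicate k True @ (pad_address ^^ k) ds"
    proof (induction k)
      case 0
      then show ?case using False by simp
    next
      case (Suc k)
      then show ?case by (simp add: pad_address_append pad_address_replicate)
    qed
    then have "pad_address ((pad_address ^^ k) (d # ds)) = False # replicate (Suc k) True @ (pad_address ^^ Suc k) ds"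
      by (simp add: pad_address_append pad_address_replicate)
    then show ?thesis using ones[of "Suc k" "Suc k"] by (rule opens_step)
  qed
qed

lemma dust_near_gap:
  assumes "x \<in> dust" "0 \<le> x" "x \<le> 1"
  shows "\<exists>ds. \<forall>w\<in>{1..2}. \<bar>gap_point ds w - x\<bar> \<le> (1 / 3) ^ n"
  using assms
proof (induction n arbitrary: x)
  case 0
  then show ?case by (intro exI[of _ "[]"]) auto
next
  case (Suc n)
  have d3: "3 * x \<in> dust" using Suc.prems in_gap_third_iff[of "3 * x"] by (simp add: dust_def)
  have "\<not> (1 < 3 * x \<and> 3 * x < 2)" using d3 in_gap.outer[of 0 "3 * x"] by (auto simp: dust_def)
  then obtain d y where y: "0 \<le> y" "y \<le> 1" "y \<in> dust" "3 * x = y + (if d then 2 else 0)"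
  proof (cases "3 * x \<le> 1")
    case True
    then show ?thesis using that[of "3 * x" False] d3 Suc.prems by simp
  next
    case False
    moreover have "3 * x + 2 * of_int (-1) \<in> dust" using d3 in_gap_shift_iff[of "3 * x" "-1"] by (simp add: dust_def)
    ultimately show ?thesis
      using that[of "3 * x - 2" True] Suc.prems \<open>\<not> (1 < 3 * x \<and> 3 * x < 2)\<close> by simp
  qed
  obtain ds where ds: "\<forall>w\<in>{1..2}. \<bar>gap_point ds w - y\<bar> \<le> (1 / 3) ^ n"
    using Suc.IH[OF y(3,1,2)] by blast
  have "\<bar>gap_point (d # ds) w - x\<bar> \<le> (1 / 3) ^ Suc n" if "w \<in> {1..2}" for w
  proof -
    have eq: "gap_point (d # ds) w - x = (gap_point ds w - y) / 3" using y(4) by (simp add: field_simps)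
    show ?thesis unfolding eq using ds that by simp
  qed
  then show ?case by blast
qed

lemma dust_neighbourhood_grows:
  assumes "x \<in> dust" "a < x" "x < b"
  shows "\<exists>j::int. grows_to {a<..<b} {1 + 2 * of_int j..2 + 2 * of_int j}"
proof -
  obtain i :: int where i: "2 * of_int i \<le> x" "x \<le> 2 * of_int i + 1"
    using assms(1) by (cases x rule: cell_cases) (auto simp: dust_def dest: in_gap.outer)
  define y where "y = x + 2 * of_int (- i)"
  have "y \<in> dust" using assms(1) in_gap_shift_iff[of x "- i"] unfolding y_def dust_def by blast
  moreover have "0 \<le> y" "y \<le> 1" using i by (simp_all add: y_def)
  moreover obtain n where n: "(1 / 3) ^ n < min (x - a) (b - x)"
    using real_arch_pow_inv[of "min (x - a) (b - x)" "1 / 3"] assms by auto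
  ultimately obtain ds where ds: "\<forall>w\<in>{1..2}. \<bar>gap_point ds w - y\<bar> \<le> (1 / 3) ^ n"
    using dust_near_gap by blast
  have "(\<lambda>w. gap_point ds w + 2 * of_int i) ` {1..2} \<subseteq> {a<..<b}"
  proof
    fix z assume "z \<in> (\<lambda>w. gap_point ds w + 2 * of_int i) ` {1..2}"
    then obtain w where w: "w \<in> {1..2}" "z = gap_point ds w + 2 * of_int i" by blast
    then have "\<bar>z - x\<bar> \<le> (1 / 3) ^ n" using bspec[OF ds w(1)] by (simp add: y_def algebra_simps)
    then show "z \<in> {a<..<b}" using n by auto
  qed
  then have "grows_to {a<..<b} ((\<lambda>w. gap_point ds w + 2 * of_int i) ` {1..2})"
    by (rule grows_to_subset)
  moreover have "opens ds" using opens_padded[of 0 ds] by simp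
  ultimately show ?thesis unfolding opens_def using grows_to_trans by blast
qed

lemma grows_to_interval:
  assumes "a \<le> b" "lift (a + 2 * of_int j) \<le> c" "d \<le> lift (b + 2 * of_int j)"
  shows "grows_to {a..b} {c..d}"
proof (rule grows_to_spread, rule subsetI)
  fix y assume "y \<in> {c..d}"
  then obtain x where "a + 2 * of_int j \<le> x" "x \<le> b + 2 * of_int j" "lift x = y"
    using lift_intermediate[of "a + 2 * of_int j" "b + 2 * of_int j" y] assms by auto
  then have "x - 2 * of_int j \<in> {a..b}" "y = lift ((x - 2 * of_int j) + 2 * of_int j)" by auto
  then show "y \<in> spread {a..b}" unfolding in_spread_iff by blast
qed

text \<open>
  The gap is translated to \<open>[5, 6]\<close>, whose left end point is fixed by \<open>lift\<close>. Its image is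
  \<open>[5, 27/4]\<close>, the next image contains \<open>[5, 33/4]\<close>, and an interval of length at least \<open>2\<close> meets all
  classes modulo \<open>2\<close>, so that its translates cover the line.
\<close>

lemma outer_gap_grows: "grows_to {1 + 2 * of_int j..2 + 2 * of_int j} UNIV"
proof -
  have l5: "lift 5 = 5" using pad_shift[of 1 2] by (simp add: lift_def pad_gap stretch_period)
  have "pad 6 = 25 / 4" using pad_shift[of 0 3] by (simp add: pad_cell pad_unit_0)
  moreover have "stretch (25 / 4) = 27 / 4" using stretch_shift[of "1 / 4" 1] by (simp add: stretch_period)
  ultimately have l6: "lift 6 = 27 / 4" by (simp only: lift_def)
  have l7: "33 / 4 \<le> lift (27 / 4)"
  proof -
    have "pad (3 / 4) = (pad (1 / 4) + 2) / 3"
      using pad_third_right[of "9 / 4"] pad_shift[of "1 / 4" 1] by simp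
    then have "3 / 4 \<le> pad (3 / 4)" using pad_unit_range[of "1 / 4"] by (simp add: pad_cell)
    then have "stretch (3 / 4) \<le> stretch (pad (3 / 4))" using strict_mono_stretch by (simp add: strict_mono_less_eq)
    moreover have "lift (27 / 4) = stretch (pad (3 / 4)) + 6"
      using lift_shift[of "3 / 4" 1] by (simp add: lift_def)
    moreover have "stretch (3 / 4) = 9 / 4" by (simp add: stretch_period)
    ultimately show ?thesis by linarith
  qed
  have "grows_to {1 + 2 * of_int j..2 + 2 * of_int j} {5..27 / 4}"
    by (rule grows_to_interval[of _ _ "2 - j"]) (use l5 l6 in simp_all)
  also have "grows_to {5..27 / 4} {5..33 / 4}"
    by (rule grows_to_interval[of _ _ 0]) (use l5 l7 in simp_all)
  also have "grows_to {5..33 / 4} UNIV"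
  proof (rule grows_to_spread, rule subsetI)
    fix y :: real
    obtain z where z: "y = lift z" using surj_lift by (auto simp: surj_def)
    define i where "i = \<lfloor>(z - 5) / 2\<rfloor>"
    have "z - 2 * of_int i \<in> {5..33 / 4}"
      using floor_correct[of "(z - 5) / 2"] unfolding i_def by (simp add: field_simps)
    moreover have "y = lift ((z - 2 * of_int i) + 2 * of_int i)" using z by simp
    ultimately show "y \<in> spread {5..33 / 4}" unfolding in_spread_iff by blast
  qed
  finally show ?thesis .
qed

text \<open>
  The interval must first reach the Cantor set; every neighbourhood of a point of that set
  contains a gap, and any gap can be opened.
\<close>

theorem open_interval_grows:
  assumes "a < b"
  shows "\<exists>n. (spread ^^ n) {a<..<b} = UNIV"
proof -
  obtain x n where x: "x \<in> {a<..<b}" "(pad ^^ n) x \<in> dust"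
    using pad_orbit_hits_dust[OF assms] by blast
  have "(lift ^^ n) x \<approx>\<^sub>g (pad ^^ n) x"
  proof (induction n)
    case (Suc n)
    then show ?case using lift_same_type[OF Suc] by simp
  qed (simp add: same_type_refl)
  then have "(lift ^^ n) x \<in> dust" using x dust_same_type by blast
  moreover have "strict_mono (lift ^^ n)"
    by (induction n) (auto simp: strict_mono_def intro: strict_mono_lift[THEN strict_monoD])
  then have "(lift ^^ n) a < (lift ^^ n) x" "(lift ^^ n) x < (lift ^^ n) b"
    using x by (auto dest: strict_monoD)
  ultimately obtain j :: int where
    "grows_to {(lift ^^ n) a<..<(lift ^^ n) b} {1 + 2 * of_int j..2 + 2 * of_int j}"
    using dust_neighbourhood_grows by blast
  then have "grows_to {a<..<b} UNIV"
    by (rule grows_to_trans[OF grows_to_trans[OF grows_to_lift_interval] outer_gap_grows])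
  then show ?thesis unfolding grows_to_def by blast
qed

section \<open>Descent to the circle\<close>

definition wrap :: "real \<Rightarrow> complex" where
  "wrap x = cis (pi / 3 * x)"

lemma wrap_eq_iff: "wrap x = wrap y \<longleftrightarrow> (\<exists>i::int. x = y + 6 * of_int i)"
proof -
  have "pi / 3 * x = pi / 3 * y + 2 * pi * of_int i \<longleftrightarrow> pi / 3 * x = pi / 3 * (y + 6 * of_int i)" for i :: int
    by (simp add: algebra_simps)
  then have "pi / 3 * x = pi / 3 * y + 2 * pi * of_int i \<longleftrightarrow> x = y + 6 * of_int i" for i :: int
    by simp
  moreover have "wrap x = wrap y \<longleftrightarrow> (\<exists>i::int. pi / 3 * x = pi / 3 * y + 2 * pi * of_int i)"
    unfolding wrap_def complex_eq_iff using sin_cos_eq_iff[of "pi / 3 * x" "pi / 3 * y"] by auto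
  ultimately show ?thesis by simp
qed

lemma wrap_in_circle: "wrap x \<in> sphere 0 1"
  by (simp add: wrap_def)

lemma circle_wrapE:
  assumes "z \<in> sphere 0 1"
  obtains x where "x \<in> {0..6}" "z = wrap x"
proof -
  have "(Re z)\<^sup>2 + (Im z)\<^sup>2 = 1" using assms by (simp add: cmod_def)
  then obtain t where t: "0 \<le> t" "t < 2 * pi" "Re z = cos t" "Im z = sin t" by (rule sincos_total_2pi)
  show ?thesis
  proof (rule that)
    show "3 / pi * t \<in> {0..6}" using t by (simp add: field_simps)
    show "z = wrap (3 / pi * t)" using t by (simp add: wrap_def complex_eq_iff)
  qed
qed

lemma wrap_image_UNIV: "wrap ` UNIV = sphere 0 1"
  using wrap_in_circle circle_wrapE by blast

lemma continuous_on_wrap: "continuous_on A wrap"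
  unfolding wrap_def by (intro continuous_intros)

text \<open>
  The restriction of \<open>wrap\<close> to a period is a closed map, hence a quotient map.
\<close>

lemma continuous_on_circle_if_lift:
  fixes h :: "complex \<Rightarrow> complex"
  assumes "continuous_on UNIV (h \<circ> wrap)"
  shows "continuous_on (sphere 0 1) h"
proof -
  have "closed (h -` B \<inter> sphere 0 1)" if "closed B" for B
  proof -
    have "h -` B \<inter> sphere 0 1 = wrap ` ({0..6} \<inter> (h \<circ> wrap) -` B)"
      using wrap_in_circle by (auto elim!: circle_wrapE)
    moreover have "compact ({0..6} \<inter> (h \<circ> wrap) -` B)"
      using continuous_closed_preimage[OF continuous_on_subset[OF assms] closed_UNIV that]
      by (intro compact_Int_closed) (auto simp: continuous_on_closed_vimage[OF closed_UNIV] assms that)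
    ultimately show ?thesis
      by (simp add: compact_imp_closed compact_continuous_image continuous_on_wrap)
  qed
  then show ?thesis by (simp add: continuous_on_closed_vimage)
qed

text \<open>
  Independent of the chosen preimage if \<open>\<phi>\<close> commutes with the translation by \<open>6\<close>.
\<close>

definition circle_map :: "(real \<Rightarrow> real) \<Rightarrow> complex \<Rightarrow> complex" where
  "circle_map \<phi> z = wrap (\<phi> (SOME x. wrap x = z))"

lemma circle_map_wrap:
  assumes "\<And>x (i::int). \<phi> (x + 6 * of_int i) = \<phi> x + 6 * of_int i"
  shows "circle_map \<phi> (wrap x) = wrap (\<phi> x)"
proof -
  have "wrap (SOME y. wrap y = wrap x) = wrap x" by (rule someI[of _ x]) simp
  then obtain i :: int where "(SOME y. wrap y = wrap x) = x + 6 * of_int i" using wrap_eq_iff by blast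
  then show ?thesis unfolding circle_map_def using assms[of x i] wrap_eq_iff by auto
qed

lemma circle_map_homeomorphism:
  assumes eq: "\<And>x (i::int). \<phi> (x + 6 * of_int i) = \<phi> x + 6 * of_int i"
    and "continuous_on UNIV \<phi>" "inj \<phi>" "surj \<phi>"
  shows "\<exists>g. homeomorphism (sphere 0 1) (sphere 0 1) (circle_map \<phi>) g"
proof -
  have comp: "circle_map \<phi> \<circ> wrap = wrap \<circ> \<phi>" using circle_map_wrap[OF eq] by auto
  have "continuous_on (sphere 0 1) (circle_map \<phi>)"
    by (intro continuous_on_circle_if_lift) (simp only: comp, intro continuous_on_compose assms(2) continuous_on_wrap)
  moreover have "circle_map \<phi> ` sphere 0 1 = sphere 0 1"
  proof -
    have "circle_map \<phi> ` wrap ` UNIV = wrap ` \<phi> ` UNIV" unfolding image_comp comp ..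
    then show ?thesis using assms(4) wrap_image_UNIV by simp
  qed
  moreover have "inj_on (circle_map \<phi>) (sphere 0 1)"
  proof (rule inj_onI)
    fix z w assume "z \<in> sphere 0 1" "w \<in> sphere 0 1" and zw: "circle_map \<phi> z = circle_map \<phi> w"
    then obtain x y where xy: "z = wrap x" "w = wrap y" by (metis circle_wrapE)
    then have "wrap (\<phi> x) = wrap (\<phi> y)" using zw circle_map_wrap[OF eq] by simp
    then obtain i :: int where "\<phi> x = \<phi> (y + 6 * of_int i)" using wrap_eq_iff eq by auto
    then have "x = y + 6 * of_int i" using assms(3) by (simp add: inj_eq)
    then show "z = w" using xy wrap_eq_iff by blast
  qed
  ultimately show ?thesis using homeomorphism_compact[OF compact_sphere] by metis
qed

text \<open>
  These are the maps of the inverse system; the system itself consists of their inverses.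
\<close>

definition backward_map :: "nat \<Rightarrow> complex \<Rightarrow> complex" where
  "backward_map j = circle_map (\<lambda>x. lift (x + 2 * of_nat j))"

lemma backward_map_wrap: "backward_map j (wrap x) = wrap (lift (x + 2 * of_nat j))"
  unfolding backward_map_def
proof (rule circle_map_wrap)
  show "lift (x + 6 * of_int i + 2 * of_nat j) = lift (x + 2 * of_nat j) + 6 * of_int i" for x i
    using lift_shift[of "x + 2 * of_nat j" i] by (simp add: add_ac)
qed

lemma backward_map_homeomorphism: "\<exists>g. homeomorphism (sphere 0 1) (sphere 0 1) (backward_map j) g"
  unfolding backward_map_def
proof (rule circle_map_homeomorphism)
  show "lift (x + 6 * of_int i + 2 * of_nat j) = lift (x + 2 * of_nat j) + 6 * of_int i" for x i
    using lift_shift[of "x + 2 * of_nat j" i] by (simp add: add_ac)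
  show "continuous_on UNIV (\<lambda>x. lift (x + 2 * of_nat j))"
    by (rule continuous_on_compose2[OF continuous_on_lift]) (auto intro!: continuous_intros)
  show "inj (\<lambda>x. lift (x + 2 * of_nat j))"
    using strict_mono_eq[OF strict_mono_lift] by (auto intro: injI)
  show "surj (\<lambda>x. lift (x + 2 * of_nat j))"
    unfolding surj_def
  proof
    fix y
    obtain x where "y = lift x" using surj_lift by (auto simp: surj_def)
    then show "\<exists>x. y = lift (x + 2 * of_nat j)" by (intro exI[of _ "x - 2 * of_nat j"]) simp
  qed
qed

lemma hutchinson_wrap:
  "(\<Union>j<3. backward_map j ` wrap ` A) = wrap ` spread A"
proof (intro equalityI subsetI)
  fix z assume "z \<in> (\<Union>j<3. backward_map j ` wrap ` A)"
  then obtain j x where "x \<in> A" "z = wrap (lift (x + 2 * of_nat j))"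
    by (auto simp: backward_map_wrap)
  then show "z \<in> wrap ` spread A" using in_spread_iff[of "lift (x + 2 * of_nat j)" A]
    by (metis image_eqI of_int_of_nat_eq)
next
  fix z assume "z \<in> wrap ` spread A"
  then obtain x and j :: int where xj: "x \<in> A" "z = wrap (lift (x + 2 * of_int j))"
    by (auto simp: in_spread_iff)
  define r i where "r = nat (j mod 3)" and "i = j div 3"
  have j: "j = int r + 3 * i" "r < 3" by (simp_all add: r_def i_def nat_less_iff)
  have "x + 2 * of_int j = (x + 2 * of_nat r) + 6 * of_int i" using j(1) by simp
  then have "z = wrap (lift (x + 2 * of_nat r))" using xj(2) lift_shift wrap_eq_iff by metis
  then have "z = backward_map r (wrap x)" by (simp add: backward_map_wrap)
  then show "z \<in> (\<Union>j<3. backward_map j ` wrap ` A)" using xj(1) j(2) by blast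
qed

text \<open>
  Modulo \<open>6\<close> the dust avoids the gap \<open>(1, 2)\<close>, so it lies in the compact image of \<open>[-4, 1]\<close>.
\<close>

lemma dust_far_from_gap_centre: "\<exists>e>0. \<forall>y\<in>dust. e \<le> dist (wrap (3 / 2)) (wrap y)"
proof -
  have "closed (wrap ` {-4..1})"
    by (intro compact_imp_closed compact_continuous_image continuous_on_wrap) simp
  moreover have "wrap (3 / 2) \<notin> wrap ` {-4..1}"
  proof
    assume "wrap (3 / 2) \<in> wrap ` {-4..1}"
    then obtain y where y: "y \<in> {-4..1}" "wrap (3 / 2) = wrap y" by blast
    from y(2) obtain i :: int where "3 / 2 = y + 6 * of_int i" unfolding wrap_eq_iff ..
    moreover have "-4 \<le> y" "y \<le> 1" using y(1) by simp_all
    ultimately have "0 < real_of_int i" "real_of_int i < 1" by linarith+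
    then show False by simp
  qed
  ultimately obtain e where e: "e > 0" "\<forall>w\<in>wrap ` {-4..1}. e \<le> dist (wrap (3 / 2)) w"
    using separate_point_closed[of "wrap ` {-4..1}" "wrap (3 / 2)"] by blast
  have "wrap y \<in> wrap ` {-4..1}" if y: "y \<in> dust" for y
  proof -
    define i where "i = \<lfloor>(y + 4) / 6\<rfloor>"
    define u where "u = y + 2 * of_int (- 3 * i)"
    have u: "-4 \<le> u" "u < 2"
      using floor_correct[of "(y + 4) / 6"] unfolding u_def i_def by (simp_all add: field_simps)
    have "u \<in> dust" using y in_gap_shift_iff[of y "- 3 * i"] unfolding u_def dust_def by blast
    then have "u \<le> 1" using u in_gap.outer[of 0 u] by (force simp: dust_def)
    moreover have "wrap y = wrap u" unfolding wrap_eq_iff by (rule exI[of _ i]) (simp add: u_def)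
    ultimately show ?thesis using u by auto
  qed
  then show ?thesis using e by blast
qed

lemma open_circle_set_contains_arc:
  assumes "openin (top_of_set (sphere 0 1)) V" "V \<noteq> {}"
  obtains a b where "a < b" "wrap ` {a<..<b} \<subseteq> V"
proof -
  obtain T where T: "open T" "V = sphere 0 1 \<inter> T" using assms(1) by (auto simp: openin_open)
  obtain x where x: "wrap x \<in> T" using assms(2) T(2) by (auto elim: circle_wrapE)
  have "open (wrap -` T)" using T(1) continuous_on_wrap by (simp add: open_vimage)
  then obtain e where e: "e > 0" "ball x e \<subseteq> wrap -` T" using openE[of "wrap -` T" x] x by blast
  have "wrap ` {x - e<..<x + e} \<subseteq> V"
    using e(2) T(2) wrap_in_circle by (auto simp: ball_eq_greaterThanLessThan)
  then show ?thesis using that[of "x - e" "x + e"] e(1) by simp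
qed

theorem theorem1:
  shows "\<exists>\<F> :: (complex \<Rightarrow> complex) set.
           homeo_ifs_on (sphere 0 1) \<F> \<and>
           hutchinson_equicontinuous (sphere 0 1) \<F> \<and>
           hutchinson_sensitive (sphere 0 1) (inverse_ifs (sphere 0 1) \<F>)"
proof -
  let ?S = "sphere 0 1 :: complex set"
  obtain f where f: "\<And>j. homeomorphism ?S ?S (backward_map j) (f j)"
    using backward_map_homeomorphism by metis
  define \<F> where "\<F> = f ` {..<3}"
  define H where "H = hutchinson (inverse_ifs ?S \<F>)"
  have ifs: "homeo_ifs_on ?S \<F>"
    unfolding homeo_ifs_on_def ifs_on_def
  proof (intro conjI ballI)
    show "compact ?S" by simp
    show "finite \<F>" "\<F> \<noteq> {}" by (auto simp: \<F>_def lessThan_empty_iff)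
    fix g assume "g \<in> \<F>"
    then obtain j where g: "g = f j" by (auto simp: \<F>_def)
    show "continuous_on ?S g" "g ` ?S \<subseteq> ?S" "\<exists>h. homeomorphism ?S ?S g h"
      using f[of j] homeomorphism_symD[OF f[of j]] unfolding g by (auto simp: homeomorphism_def)
  qed
  have inv: "inv_into ?S (f j) z = backward_map j z" if "z \<in> ?S" for j z
    using f[of j] that by (intro inv_into_f_eq) (auto simp: homeomorphism_def intro: inj_on_inverseI)
  have step: "H (wrap ` A) = wrap ` spread A" for A
  proof -
    have "H (wrap ` A) = (\<Union>j<3. inv_into ?S (f j) ` wrap ` A)"
      by (auto simp: H_def hutchinson_def inverse_ifs_def \<F>_def)
    also have "\<dots> = (\<Union>j<3. backward_map j ` wrap ` A)"
      by (intro SUP_cong image_cong refl inv) (auto simp: wrap_def)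
    finally show ?thesis by (simp only: hutchinson_wrap)
  qed
  have orbit: "(H ^^ n) (wrap ` A) = wrap ` (spread ^^ n) A" for n A
    by (induction n) (simp_all add: step)
  have exact: "backward_exact ?S \<F>"
    unfolding backward_exact_def H_def[symmetric]
  proof (intro allI impI, elim conjE)
    fix V assume V: "openin (top_of_set ?S) V" "V \<noteq> {}"
    obtain a b where ab: "a < b" "wrap ` {a<..<b} \<subseteq> V" by (rule open_circle_set_contains_arc[OF V])
    obtain n where "(spread ^^ n) {a<..<b} = UNIV" using open_interval_grows[OF ab(1)] by blast
    then have "(H ^^ n) (wrap ` {a<..<b}) = ?S" by (simp add: orbit wrap_image_UNIV)
    moreover have "(H ^^ n) (wrap ` {a<..<b}) \<subseteq> (H ^^ n) V"
      unfolding H_def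
      by (subst (1 2) hutchinson_funpow_points) (use ab(2) in blast)
    ultimately show "\<exists>n. ?S \<subseteq> (H ^^ n) V" by blast
  qed
  obtain e where e: "e > 0" "\<And>y. y \<in> dust \<Longrightarrow> e \<le> dist (wrap (3 / 2)) (wrap y)"
    using dust_far_from_gap_centre by blast
  have "hutchinson_sensitive ?S (inverse_ifs ?S \<F>)"
  proof (rule inverse_sensitive_if_trapped[OF ifs exact wrap_in_circle e(1)], fold H_def)
    fix V assume V: "openin (top_of_set ?S) V" "V \<noteq> {}"
    obtain a b where ab: "a < b" "wrap ` {a<..<b} \<subseteq> V" by (rule open_circle_set_contains_arc[OF V])
    obtain x N where x: "x \<in> {a<..<b}" "\<And>n. n \<ge> N \<Longrightarrow> (spread ^^ n) {x} \<subseteq> dust"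
      using spread_orbit_trapped[OF ab(1)] by blast
    have "\<forall>z\<in>(H ^^ n) {wrap x}. e \<le> dist (wrap (3 / 2)) z" if "n \<ge> N" for n
      using orbit[of n "{x}"] x(2)[OF that] e(2) by auto
    then show "\<exists>x\<in>V. \<exists>N. \<forall>n\<ge>N. \<forall>z\<in>(H ^^ n) {x}. e \<le> dist (wrap (3 / 2)) z"
      using ab(2) x(1) by blast
  qed
  then show ?thesis using ifs equicontinuous_if_backward_exact[OF ifs exact] by blast
qed

end
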